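(* Let $U\in\mathcal C^2(\mathbb R^d)$ and $0<m\le L$ be such that for all $x,y\in\mathbb R^d$, $|\nabla U(x)-\nabla U(y)|\le L|x-y|$ and $(x-y)\cdot(\nabla U(x)-\nabla U(y))\ge m|x-y|^2$. Suppose moreover that $\gamma\ge 2\sqrt L$ and $0<\delta\le m/(33\gamma^3)$. Let $P$ be the transition operator of the OBABO chain with parameters $\delta,\gamma$ and potential $U$. Then for all $p\ge 1$, $n\in\mathbb N$ and all $\nu,\mu\in\mathcal P_p(\mathbb R^{2d})$, $$\mathcal W_p(\nu P^n,\mu P^n)\ \le\ K_1(1-\delta\kappa)^{n/2}\,\mathcal W_p(\nu,\mu),$$ with $$K_1=\sqrt3\,\max\left(L^{1/2},L^{-1/2}\right),\qquad \kappa=\frac{m}{3\gamma}.$$ Moreover, $P$ admits a unique invariant probability distribution $\pi_\delta$, and $\pi_\delta\in\mathcal P_p(\mathbb R^{2d})$ for all $p\ge1$.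
   Context: Given a time-step $\delta>0$ and a friction $\gamma>0$, set $\eta=e^{-\delta\gamma/2}$. The OBABO chain is the time-homogeneous Markov chain on $\mathbb R^d\times\mathbb R^d$ whose transition from $(x_0,v_0)$ to $(x_1,v_1)$ is $$x_1=x_0+\delta\left(\eta v_0+\sqrt{1-\eta^2}\,G\right)-\frac{\delta^2}{2}\nabla U(x_0),$$ $$v_1=\eta^2v_0-\frac{\delta\eta}{2}\left(\nabla U(x_0)+\nabla U(x_1)\right)+\sqrt{1-\eta^2}\left(\eta G+G'\right),$$ where $G,G'$ are independent standard Gaussian vectors in $\mathbb R^d$. $P$ denotes its transition operator, $P\varphi(x_0,v_0)=\mathbb E\varphi(x_1,v_1)$, and $\nu P$ denotes the law after one step from initial law $\nu$. $\mathcal P_p(\mathbb R^{2d})$ is the set of probability measures with finite $p$-th moment, and $\mathcal W_p$ is the $p$-Wasserstein distance associated with the Euclidean norm $|\cdot|$. *)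

theory Defs
  imports "HOL-Probability.Probability"
begin

text \<open>The phase space is the product type \<^typ>\<open>'a \<times> 'a\<close>, whose library norm is the Euclidean norm
  \<open>sqrt ((norm x)\<^sup>2 + (norm v)\<^sup>2)\<close>.\<close>

definition gradient :: "('a::euclidean_space \<Rightarrow> real) \<Rightarrow> 'a \<Rightarrow> 'a" where
  "gradient U x = (THE D. GDERIV U x :> D)"

text \<open>Twice continuously differentiable: the Hessian is the derivative \<open>H\<close> of the gradient,
  continuous in operator norm.\<close>

definition C2 :: "('a::euclidean_space \<Rightarrow> real) \<Rightarrow> bool" where
  "C2 U \<longleftrightarrow> (\<forall>x. GDERIV U x :> gradient U x) \<and>
     (\<exists>H :: 'a \<Rightarrow> 'a \<Rightarrow>\<^sub>L 'a.
        (\<forall>x. (gradient U has_derivative blinfun_apply (H x)) (at x)) \<and> continuous_on UNIV H)"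

definition std_gaussian :: "'a::euclidean_space measure" where
  "std_gaussian = density lborel (\<lambda>x. ennreal (\<Prod>b\<in>Basis. std_normal_density (x \<bullet> b)))"

definition obabo_step ::
  "('a::euclidean_space \<Rightarrow> real) \<Rightarrow> real \<Rightarrow> real \<Rightarrow> 'a \<times> 'a \<Rightarrow> 'a \<times> 'a \<Rightarrow> 'a \<times> 'a" where
  "obabo_step U \<gamma> \<delta> = (\<lambda>(x0, v0) (G, G').
     let \<eta> = exp (- \<delta> * \<gamma> / 2);
         x1 = x0 + \<delta> *\<^sub>R (\<eta> *\<^sub>R v0 + sqrt (1 - \<eta>\<^sup>2) *\<^sub>R G) - (\<delta>\<^sup>2 / 2) *\<^sub>R gradient U x0;
         v1 = \<eta>\<^sup>2 *\<^sub>R v0 - (\<delta> * \<eta> / 2) *\<^sub>R (gradient U x0 + gradient U x1)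
              + sqrt (1 - \<eta>\<^sup>2) *\<^sub>R (\<eta> *\<^sub>R G + G')
     in (x1, v1))"

definition obabo_kernel ::
  "('a::euclidean_space \<Rightarrow> real) \<Rightarrow> real \<Rightarrow> real \<Rightarrow> 'a \<times> 'a \<Rightarrow> ('a \<times> 'a) measure" where
  "obabo_kernel U \<gamma> \<delta> z = distr (std_gaussian \<Otimes>\<^sub>M std_gaussian) borel (obabo_step U \<gamma> \<delta> z)"

text \<open>The right action \<open>\<nu> P\<close> on initial laws, as a bind of the Giry monad. This is meaningful once the
  kernel is measurable in the starting point, which holds whenever \<open>gradient U\<close> is continuous.\<close>

definition obabo ::
  "('a::euclidean_space \<Rightarrow> real) \<Rightarrow> real \<Rightarrow> real \<Rightarrow> ('a \<times> 'a) measure \<Rightarrow> ('a \<times> 'a) measure" where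
  "obabo U \<gamma> \<delta> \<nu> = \<nu> \<bind> obabo_kernel U \<gamma> \<delta>"

definition borel_prob :: "'b::topological_space measure set" where
  "borel_prob = {\<nu>. prob_space \<nu> \<and> sets \<nu> = sets borel}"

definition prob_moment :: "real \<Rightarrow> 'b::euclidean_space measure set" where
  "prob_moment p = {\<nu> \<in> borel_prob. (\<integral>\<^sup>+ z. ennreal (norm z powr p) \<partial>\<nu>) < \<infinity>}"

definition couplings ::
  "'b::euclidean_space measure \<Rightarrow> 'b measure \<Rightarrow> ('b \<times> 'b) measure set" where
  "couplings \<nu> \<mu> = {\<rho> \<in> borel_prob. distr \<rho> borel fst = \<nu> \<and> distr \<rho> borel snd = \<mu>}"

text \<open>Powers of extended nonnegative reals are not in the library; the exponent is meant to be positive.\<close>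

definition ennreal_powr :: "ennreal \<Rightarrow> real \<Rightarrow> ennreal" where
  "ennreal_powr c a = (if c = \<infinity> then \<infinity> else ennreal (enn2real c powr a))"

text \<open>The value is extended real, so that an infinite distance is never silently replaced by 0.\<close>

definition wasserstein ::
  "real \<Rightarrow> 'b::euclidean_space measure \<Rightarrow> 'b measure \<Rightarrow> ennreal" where
  "wasserstein p \<nu> \<mu> =
     ennreal_powr (INF \<rho> \<in> couplings \<nu> \<mu>. \<integral>\<^sup>+ (z, z'). ennreal (dist z z' powr p) \<partial>\<rho>) (1 / p)"

end

theory Submission
  imports Defs
begin

text \<open>Couple two copies of the chain by using the same Gaussian vectors. The difference of the two copies
  then evolves without noise, and the quadratic form \<open>|x|\<^sup>2 + (2 / \<gamma>) (x \<bullet> v) + |v|\<^sup>2 / L\<close> of this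
  difference shrinks by the factor \<open>1 - \<delta> \<kappa>\<close> at every step: the gradient at the new position is not close
  to the gradient at the old one, but both are cocoercive, and cocoercivity absorbs the cross terms
  between velocity and force. Since the form lies between multiples of \<open>|x|\<^sup>2 + |v|\<^sup>2\<close> whose ratio is \<open>K\<^sub>1\<^sup>2\<close>, the Wasserstein
  bound follows for every \<open>p\<close>. Uniqueness comes from coupling two invariant laws; an invariant law with
  all moments is the law of the almost sure limit of the random maps composed in reversed order.\<close>

subsection \<open>Contraction of one noiseless step\<close>

text \<open>The obstacle is that strong convexity is weak compared with the forces: a force
  difference \<open>u\<close> may be as large as \<open>L |x|\<close>, while strong monotonicity
  alone returns only \<open>m |x|^2\<close>. Cocoercivity bounds \<open>|u|^2\<close> by
  \<open>L\<close> times the dissipation \<open>x \<bullet> u\<close>, so the products of velocity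
  and force cost fixed fractions of the friction and of the dissipation. This is why a friction of
  order \<open>sqrt L\<close> suffices, whatever \<open>m / L\<close> is. The weight
  \<open>2 / \<gamma>\<close> makes the coefficient of \<open>x \<bullet> v\<close> vanish to first
  order in the time step; the bound on \<open>\<delta>\<close> pays for the second-order errors that
  remain. The exponent \<open>n / 2\<close> appears because the estimate concerns the square of a
  norm. Uniqueness is claimed among all laws, also those with infinite moments, where the
  Wasserstein bound may say nothing. There the coupling is measured by the probability that the
  copies are far apart. The reversed composition realises all iterates on one probability space, so
  that existence needs only completeness of the phase space.\<close>

text \<open>Here \<open>x\<close> and \<open>v\<close> are the differences of positions and
  velocities of the two copies, \<open>u0\<close> and \<open>u1\<close> those of the gradients at
  the old and new positions, in units where \<open>L = 1\<close>. Balance per unit of time, to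
  leading order: friction removes \<open>2 \<gamma> |v|^2\<close>; the cross term of the form
  returns at most a quarter of it; the products of \<open>v\<close> with \<open>u0\<close> and
  \<open>u1\<close> return half of it and use up half of the dissipation
  \<open>(x \<bullet> u0 + x1 \<bullet> u1) / \<gamma>\<close>. The other half is at least about
  \<open>m |x|^2 / \<gamma>\<close>.\<close>

lemma one_step_contraction:
  fixes x v u0 u1 :: "'a::real_inner" and m \<gamma> \<delta> \<eta> :: real
  assumes m: "0 < m" "m \<le> 1" and g: "2 \<le> \<gamma>" and d: "0 < \<delta>" "\<delta> \<le> m / (33 * \<gamma> ^ 3)"
    and eta: "\<eta> = exp (- \<delta> * \<gamma> / 2)"
    and x1: "x1 = x + (\<delta> * \<eta>) *\<^sub>R v - (\<delta>\<^sup>2 / 2) *\<^sub>R u0"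
    and v1: "v1 = \<eta>\<^sup>2 *\<^sub>R v - (\<delta> * \<eta> / 2) *\<^sub>R (u0 + u1)"
    and u0: "(norm u0)\<^sup>2 \<le> x \<bullet> u0" "m * (norm x)\<^sup>2 \<le> x \<bullet> u0"
    and u1: "(norm u1)\<^sup>2 \<le> x1 \<bullet> u1" "m * (norm x1)\<^sup>2 \<le> x1 \<bullet> u1"
  shows "(norm x1)\<^sup>2 + 2 / \<gamma> * (x1 \<bullet> v1) + (norm v1)\<^sup>2
    \<le> (1 - \<delta> * (m / (3 * \<gamma>))) * ((norm x)\<^sup>2 + 2 / \<gamma> * (x \<bullet> v) + (norm v)\<^sup>2)"
proof -
  define h where "h = \<delta> * \<gamma>"
  define X2 where "X2 = (norm x)\<^sup>2"
  define V2 where "V2 = (norm v)\<^sup>2"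
  define A2 where "A2 = (norm u0)\<^sup>2"
  define B2 where "B2 = (norm u1)\<^sup>2"
  define Y2 where "Y2 = (norm x1)\<^sup>2"
  define p where "p = x \<bullet> u0"
  define s where "s = x1 \<bullet> u1"
  have g0: "0 < \<gamma>" using g by simp
  have h0: "0 < h" using d g0 by (simp add: h_def)
  have dh: "\<delta> = h / \<gamma>" using g0 by (simp add: h_def)
  have g2: "4 \<le> \<gamma>\<^sup>2" using power_mono[OF g, of 2] by simp
  have hm: "33 * \<gamma>\<^sup>2 * h \<le> m"
    using d g0 by (simp add: h_def field_simps power2_eq_square power3_eq_cube)
  have "4 * (33 * h) \<le> \<gamma>\<^sup>2 * (33 * h)" by (rule mult_right_mono[OF g2]) (use h0 in simp)
  then have h1: "132 * h \<le> m" using hm by (simp add: mult_ac)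
  have h132: "h \<le> 1 / 132" using h1 m by simp
  have d2: "\<delta> \<le> h / 2" using g d mult_left_mono[OF g, of \<delta>] by (simp add: h_def)
  have nn: "0 \<le> X2" "0 \<le> V2" "0 \<le> A2" "0 \<le> B2" "0 \<le> Y2"
    by (simp_all add: X2_def V2_def A2_def B2_def Y2_def)
  have pA: "A2 \<le> p" and sB: "B2 \<le> s" and pm: "m * X2 \<le> p" and sm: "m * Y2 \<le> s"
    using u0 u1 by (simp_all add: X2_def A2_def B2_def Y2_def p_def s_def)
  have p0: "0 \<le> p" and s0: "0 \<le> s" using pA sB nn by linarith+
  have eta1: "1 - h / 2 \<le> \<eta>" using exp_ge_add_one_self[of "- h / 2"] by (simp add: eta h_def)
  \<comment> \<open>An upper bound for \<open>exp (- t)\<close> from the lower Taylor bound for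
    \<open>exp t\<close>: the two quadratic polynomials have product \<open>1 + t ^ 4 / 4\<close>,
    which is at least 1.\<close>
  have exp_quad: "exp (- t) \<le> 1 - t + t\<^sup>2 / 2" if "0 \<le> t" for t :: real
  proof -
    have "exp (- t) = 1 / exp t" by (simp add: exp_minus field_simps)
    also have "\<dots> \<le> 1 / (1 + t + t\<^sup>2 / 2)"
      using exp_lower_Taylor_quadratic[OF that] that by (intro divide_left_mono) (auto intro!: mult_pos_pos add_pos_nonneg)
    also have "\<dots> \<le> 1 - t + t\<^sup>2 / 2"
    proof -
      have "(1 - t + t\<^sup>2 / 2) * (1 + t + t\<^sup>2 / 2) = 1 + t ^ 4 / 4"
        by (simp add: power2_eq_square power4_eq_xxxx algebra_simps)
      moreover have "0 < 1 + t + t\<^sup>2 / 2" using that by (auto intro!: add_pos_nonneg)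
      ultimately show ?thesis by (simp add: pos_divide_le_eq)
    qed
    finally show ?thesis .
  qed
  have eta2: "\<eta> \<le> 1 - h / 2 + h\<^sup>2 / 8"
    using exp_quad[of "h / 2"] h0 by (simp add: eta h_def power2_eq_square)
  have eta4: "\<eta> ^ 4 \<le> 1 - 2 * h + 2 * h\<^sup>2"
  proof -
    have "\<eta> ^ 4 = exp (- (2 * h))"
      by (simp add: eta h_def exp_of_nat_mult[symmetric] field_simps)
    then show ?thesis using exp_quad[of "2 * h"] h0 by (simp add: power2_eq_square)
  qed
  have eta0: "0 < \<eta>" by (simp add: eta)
  have etale: "\<eta> \<le> 1" using d g0 by (simp add: eta)
  have eta_le: "\<eta> ^ k \<le> 1" for k using eta0 etale by (simp add: power_le_one)
  have cs: "\<bar>a \<bullet> b\<bar> \<le> t / 2 * (norm a)\<^sup>2 + (norm b)\<^sup>2 / (2 * t)" if "0 < t" for a b :: 'a and t :: real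
  proof -
    have "\<bar>a \<bullet> b\<bar> \<le> norm a * norm b" by (rule Cauchy_Schwarz_ineq2)
    also have "\<dots> \<le> t / 2 * (norm a)\<^sup>2 + (norm b)\<^sup>2 / (2 * t)"
    proof -
      have "0 \<le> (t * norm a - norm b)\<^sup>2" by simp
      then have "2 * t * (norm a * norm b) \<le> t\<^sup>2 * (norm a)\<^sup>2 + (norm b)\<^sup>2"
        by (simp add: power2_diff power_mult_distrib mult_ac)
      then show ?thesis using that by (simp add: field_simps power2_eq_square)
    qed
    finally show ?thesis .
  qed

  \<comment> \<open>Coefficients of \<open>x \<bullet> v\<close>, \<open>V2\<close>,
    \<open>v \<bullet> u0\<close> (with a minus sign) and \<open>A2\<close> in the exact change of
    the form. To first order \<open>1 - \<eta>\<^sup>2\<close> is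
    \<open>\<delta> * \<gamma>\<close>, so both parts of \<open>c\<close> cancel: this fixes the
    weight \<open>2 / \<gamma>\<close>.\<close>
  define c where "c = 2 * \<delta> * \<eta> + 2 / \<gamma> * (\<eta>\<^sup>2 - 1)"
  define k1 where "k1 = \<delta>\<^sup>2 * \<eta>\<^sup>2 + 2 / \<gamma> * \<delta> * \<eta> ^ 3 + \<eta> ^ 4 - 1"
  define k2 where "k2 = \<delta> * \<eta> ^ 3 + 2 * \<delta>\<^sup>2 * \<eta>\<^sup>2 / \<gamma> + \<delta> ^ 3 * \<eta>"
  define k3 where "k3 = \<delta> ^ 4 / 4 + \<delta> ^ 3 * \<eta> / (2 * \<gamma>)"
  have X1: "Y2 = X2 + 2 * \<delta> * \<eta> * (x \<bullet> v) - \<delta>\<^sup>2 * p + \<delta>\<^sup>2 * \<eta>\<^sup>2 * V2 - \<delta> ^ 3 * \<eta> * (v \<bullet> u0) + \<delta> ^ 4 / 4 * A2"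
    unfolding Y2_def X2_def V2_def A2_def p_def x1 power2_norm_eq_inner
    by (simp add: inner_simps inner_commute power2_eq_square power3_eq_cube power4_eq_xxxx algebra_simps)
  have XV: "x1 \<bullet> v1 = \<eta>\<^sup>2 * (x \<bullet> v) + \<delta> * \<eta> ^ 3 * V2 - \<delta>\<^sup>2 * \<eta>\<^sup>2 * (v \<bullet> u0)
     - \<delta> * \<eta> / 2 * p + \<delta> ^ 3 * \<eta> / 4 * A2 - \<delta> * \<eta> / 2 * s"
  proof -
    have "x1 \<bullet> v1 = \<eta>\<^sup>2 * (x1 \<bullet> v) - \<delta> * \<eta> / 2 * (x1 \<bullet> u0) - \<delta> * \<eta> / 2 * s"
      by (simp add: v1 s_def inner_simps algebra_simps)
    also have "x1 \<bullet> v = x \<bullet> v + \<delta> * \<eta> * V2 - \<delta>\<^sup>2 / 2 * (v \<bullet> u0)"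
      by (simp add: x1 V2_def power2_norm_eq_inner inner_simps inner_commute algebra_simps)
    also have "x1 \<bullet> u0 = p + \<delta> * \<eta> * (v \<bullet> u0) - \<delta>\<^sup>2 / 2 * A2"
      by (simp add: x1 A2_def p_def power2_norm_eq_inner inner_simps inner_commute algebra_simps)
    finally show ?thesis
      by (simp add: power2_eq_square power3_eq_cube algebra_simps)
  qed
  have V1: "(norm v1)\<^sup>2 = \<eta> ^ 4 * V2 - \<delta> * \<eta> ^ 3 * (v \<bullet> u0) - \<delta> * \<eta> ^ 3 * (v \<bullet> u1) + \<delta>\<^sup>2 * \<eta>\<^sup>2 / 4 * (norm (u0 + u1))\<^sup>2"
    unfolding v1 V2_def power2_norm_eq_inner
    by (simp add: inner_simps inner_commute power2_eq_square power3_eq_cube power4_eq_xxxx algebra_simps)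
  have expand: "Y2 + 2 / \<gamma> * (x1 \<bullet> v1) + (norm v1)\<^sup>2 - (X2 + 2 / \<gamma> * (x \<bullet> v) + V2)
     = c * (x \<bullet> v) + k1 * V2 - (\<delta>\<^sup>2 + \<delta> * \<eta> / \<gamma>) * p - k2 * (v \<bullet> u0) - \<delta> * \<eta> ^ 3 * (v \<bullet> u1)
       - \<delta> * \<eta> / \<gamma> * s + k3 * A2 + \<delta>\<^sup>2 * \<eta>\<^sup>2 / 4 * (norm (u0 + u1))\<^sup>2"
    unfolding X1 XV V1 c_def k1_def k2_def k3_def using g0 by (simp add: field_simps)

  \<comment> \<open>The two-sided enclosure of \<open>\<eta>\<close> is needed: in
    \<open>h * \<eta> - 1 + \<eta>\<^sup>2\<close> all terms linear in \<open>h\<close> cancel, and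
    what is left lies between \<open>- h\<^sup>2 / 4\<close> and \<open>h ^ 4 / 64\<close>.\<close>
  have T1: "c * (x \<bullet> v) \<le> \<delta> * (h / 4 * (X2 + V2))"
  proof -
    have "h * (1 - h / 2) \<le> h * \<eta>" by (rule mult_left_mono[OF eta1]) (use h0 in simp)
    moreover have "(1 - h / 2)\<^sup>2 \<le> \<eta>\<^sup>2" by (rule power_mono[OF eta1]) (use h132 in simp)
    moreover have "h * \<eta> \<le> h * (1 - h / 2 + h\<^sup>2 / 8)" by (rule mult_left_mono[OF eta2]) (use h0 in simp)
    moreover have "\<eta>\<^sup>2 \<le> (1 - h / 2 + h\<^sup>2 / 8)\<^sup>2" by (rule power_mono[OF eta2]) (use eta0 in simp)
    moreover have "(1 - h / 2)\<^sup>2 = 1 - h + h\<^sup>2 / 4" by (simp add: power2_eq_square algebra_simps)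
    moreover have "(1 - h / 2 + h\<^sup>2 / 8)\<^sup>2 = 1 - h + h\<^sup>2 / 2 - h ^ 3 / 8 + h ^ 4 / 64"
      by (simp add: power2_eq_square power3_eq_cube power4_eq_xxxx algebra_simps)
    moreover have "h * (1 - h / 2) = h - h\<^sup>2 / 2" "h * (1 - h / 2 + h\<^sup>2 / 8) = h - h\<^sup>2 / 2 + h ^ 3 / 8"
      by (simp_all add: power2_eq_square power3_eq_cube algebra_simps)
    moreover have "h ^ 4 \<le> h\<^sup>2" using h0 h132 by (intro power_decreasing) auto
    moreover have "0 \<le> h\<^sup>2" by simp
    ultimately have "\<bar>h * \<eta> - 1 + \<eta>\<^sup>2\<bar> \<le> h\<^sup>2 / 4"
      unfolding abs_le_iff by (intro conjI; linarith)
    moreover have "c = 2 / \<gamma> * (h * \<eta> - 1 + \<eta>\<^sup>2)" using g0 by (simp add: c_def h_def field_simps)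
    moreover from this have "\<bar>c\<bar> = \<bar>2 / \<gamma>\<bar> * \<bar>h * \<eta> - 1 + \<eta>\<^sup>2\<bar>" by (simp only: abs_mult)
    ultimately have "\<bar>c\<bar> \<le> 2 / \<gamma> * (h\<^sup>2 / 4)"
      using g0 by (simp only:) (intro mult_mono; simp)
    also have "\<dots> = \<delta> * (h / 2)" using g0 by (simp add: h_def power2_eq_square)
    finally have "\<bar>c\<bar> * \<bar>x \<bullet> v\<bar> \<le> \<delta> * (h / 2) * (1 / 2 * X2 + V2 / 2)"
      using cs[of 1 x v] d h0 nn by (intro mult_mono) (auto simp: X2_def V2_def)
    moreover have "c * (x \<bullet> v) \<le> \<bar>c\<bar> * \<bar>x \<bullet> v\<bar>" by (simp add: abs_mult[symmetric])
    ultimately show ?thesis by (simp add: algebra_simps)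
  qed
  have T2: "k1 * V2 \<le> \<delta> * (\<gamma> * (- 3 / 2 + 9 / 4 * h)) * V2"
  proof (rule mult_right_mono[OF _ nn(2)])
    have "\<delta>\<^sup>2 * \<eta>\<^sup>2 \<le> \<delta>\<^sup>2 * 1" by (rule mult_left_mono[OF eta_le]) simp
    moreover have "2 / \<gamma> * \<delta> * \<eta> ^ 3 \<le> 2 / \<gamma> * \<delta> * 1"
      by (rule mult_left_mono[OF eta_le]) (use g0 d in simp)
    moreover have "\<delta>\<^sup>2 \<le> (h / 2)\<^sup>2" by (rule power_mono[OF d2]) (use d in simp)
    moreover have "2 / \<gamma> * \<delta> \<le> h / 2"
    proof -
      have "2 / \<gamma> * \<delta> = h * (2 / \<gamma>\<^sup>2)" using g0 by (simp add: h_def power2_eq_square)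
      also have "\<dots> \<le> h * (1 / 2)" using h0 g2 by (intro mult_left_mono) (simp_all add: divide_le_eq)
      finally show ?thesis by simp
    qed
    ultimately have "k1 \<le> - 3 / 2 * h + 9 / 4 * h\<^sup>2"
      using eta4 unfolding k1_def by (simp add: power_divide)
    also have "\<dots> = \<delta> * (\<gamma> * (- 3 / 2 + 9 / 4 * h))" by (simp add: h_def power2_eq_square algebra_simps)
    finally show "k1 \<le> \<delta> * (\<gamma> * (- 3 / 2 + 9 / 4 * h))" .
  qed
  have eg: "\<delta> / \<gamma> * (1 - h / 2) \<le> \<delta> * \<eta> / \<gamma>"
    using mult_left_mono[OF eta1, of "\<delta> / \<gamma>"] d g0 by (simp add: algebra_simps)
  have T3: "\<delta> / \<gamma> * (1 - h / 2) * p \<le> (\<delta>\<^sup>2 + \<delta> * \<eta> / \<gamma>) * p"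
    using eg by (intro mult_right_mono[OF _ p0]) (smt (verit) zero_le_power2)
  have T4: "\<delta> / \<gamma> * (1 - h / 2) * s \<le> \<delta> * \<eta> / \<gamma> * s"
    by (rule mult_right_mono[OF eg s0])
  \<comment> \<open>Young's inequality with weight \<open>\<gamma>\<close>, then cocoercivity. The
    weight balances the budget: together the two products cost
    \<open>\<delta> * \<gamma> * V2\<close> of the \<open>3 / 2 * \<delta> * \<gamma> * V2\<close>
    provided by \<open>T2\<close>, and half of the dissipation in \<open>T3\<close> and
    \<open>T4\<close>.\<close>
  have vu: "\<bar>v \<bullet> u0\<bar> \<le> \<gamma> / 2 * V2 + p / (2 * \<gamma>)" "\<bar>v \<bullet> u1\<bar> \<le> \<gamma> / 2 * V2 + s / (2 * \<gamma>)"
  proof -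
    have "A2 / (2 * \<gamma>) \<le> p / (2 * \<gamma>)" "B2 / (2 * \<gamma>) \<le> s / (2 * \<gamma>)"
      using pA sB g0 by (simp_all add: divide_right_mono)
    then show "\<bar>v \<bullet> u0\<bar> \<le> \<gamma> / 2 * V2 + p / (2 * \<gamma>)" "\<bar>v \<bullet> u1\<bar> \<le> \<gamma> / 2 * V2 + s / (2 * \<gamma>)"
      using cs[OF g0, of v u0] cs[OF g0, of v u1] by (simp_all add: V2_def A2_def B2_def)
  qed
  have dle: "\<delta> \<le> 1" "\<delta> \<le> 1 / 264" using d2 h132 by simp_all
  have T5: "- (k2 * (v \<bullet> u0)) \<le> \<delta> * (1 + 2 * \<delta>) * (\<gamma> / 2 * V2 + p / (2 * \<gamma>))"
  proof -
    have k2_0: "0 \<le> k2" using d g0 eta0 by (simp add: k2_def)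
    have "\<delta> * \<eta> ^ 3 \<le> \<delta> * 1" by (rule mult_left_mono[OF eta_le]) (use d in simp)
    moreover have "2 * \<delta>\<^sup>2 * \<eta>\<^sup>2 / \<gamma> \<le> \<delta>\<^sup>2"
    proof -
      have "2 * \<delta>\<^sup>2 * \<eta>\<^sup>2 \<le> 2 * \<delta>\<^sup>2 * 1" by (rule mult_left_mono[OF eta_le]) simp
      also have "\<dots> \<le> \<delta>\<^sup>2 * \<gamma>" using g mult_left_mono[OF g, of "\<delta>\<^sup>2"] by simp
      finally show ?thesis using g0 by (simp add: field_simps)
    qed
    moreover have "\<delta> ^ 3 * \<eta> \<le> \<delta>\<^sup>2 * 1"
    proof (rule mult_mono)
      show "\<delta> ^ 3 \<le> \<delta>\<^sup>2" using d dle by (intro power_decreasing) auto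
    qed (use etale eta0 in auto)
    ultimately have "k2 \<le> \<delta> * (1 + 2 * \<delta>)" by (simp add: k2_def power2_eq_square algebra_simps)
    then have "k2 * \<bar>v \<bullet> u0\<bar> \<le> \<delta> * (1 + 2 * \<delta>) * (\<gamma> / 2 * V2 + p / (2 * \<gamma>))"
      using vu k2_0 d by (intro mult_mono) auto
    moreover have "- (k2 * (v \<bullet> u0)) \<le> k2 * \<bar>v \<bullet> u0\<bar>"
      using mult_left_mono[of "- (v \<bullet> u0)" "\<bar>v \<bullet> u0\<bar>" k2] k2_0 by simp
    ultimately show ?thesis by linarith
  qed
  have T6: "- (\<delta> * \<eta> ^ 3 * (v \<bullet> u1)) \<le> \<delta> * (\<gamma> / 2 * V2 + s / (2 * \<gamma>))"
  proof -
    have "\<delta> * \<eta> ^ 3 \<le> \<delta> * 1" by (rule mult_left_mono[OF eta_le]) (use d in simp)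
    then have "\<delta> * \<eta> ^ 3 * \<bar>v \<bullet> u1\<bar> \<le> \<delta> * (\<gamma> / 2 * V2 + s / (2 * \<gamma>))"
      using vu d eta0 by (intro mult_mono) auto
    moreover have "- (\<delta> * \<eta> ^ 3 * (v \<bullet> u1)) \<le> \<delta> * \<eta> ^ 3 * \<bar>v \<bullet> u1\<bar>"
      using mult_left_mono[of "- (v \<bullet> u1)" "\<bar>v \<bullet> u1\<bar>" "\<delta> * \<eta> ^ 3"] d eta0 by simp
    ultimately show ?thesis by linarith
  qed
  have T7: "k3 * A2 \<le> \<delta>\<^sup>2 / 2 * p"
  proof (rule mult_mono[OF _ pA])
    have "\<delta> ^ 4 \<le> \<delta>\<^sup>2" "\<delta> ^ 3 \<le> \<delta>\<^sup>2" using d dle by (auto intro: power_decreasing)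
    moreover have "\<delta> ^ 3 * \<eta> / (2 * \<gamma>) \<le> \<delta> ^ 3 * 1 / 4"
      using d g eta0 etale by (intro frac_le mult_left_mono) auto
    ultimately show "k3 \<le> \<delta>\<^sup>2 / 2" unfolding k3_def by linarith
  qed (use nn in auto)
  have T8: "\<delta>\<^sup>2 * \<eta>\<^sup>2 / 4 * (norm (u0 + u1))\<^sup>2 \<le> \<delta>\<^sup>2 / 4 * (2 * p + 2 * s)"
  proof (rule mult_mono)
    show "\<delta>\<^sup>2 * \<eta>\<^sup>2 / 4 \<le> \<delta>\<^sup>2 / 4" using mult_left_mono[OF eta_le[of 2], of "\<delta>\<^sup>2"] by simp
    have "(norm (u0 + u1))\<^sup>2 + (norm (u0 - u1))\<^sup>2 = 2 * A2 + 2 * B2"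
      by (simp add: A2_def B2_def power2_norm_eq_inner inner_simps inner_commute)
    then show "(norm (u0 + u1))\<^sup>2 \<le> 2 * p + 2 * s"
      using pA sB by (smt (verit) zero_le_power2)
  qed auto
  \<comment> \<open>The dissipation \<open>s\<close> controls the new position only, so
    \<open>Y2\<close> has to be brought back to \<open>X2\<close>. The square \<open>w\<close> of
    the displacement is discarded, and the cross term costs \<open>\<delta> * V2\<close>, which
    friction can afford.\<close>
  have Y2_ge: "(1 - 2 * \<delta>) * X2 - \<delta> * V2 \<le> Y2"
  proof -
    have "A2 \<le> X2"
    proof -
      have "norm u0 * norm u0 \<le> norm x * norm u0"
        using u0(1) Cauchy_Schwarz_ineq2[of x u0] by (simp add: power2_eq_square)
      then have "norm u0 \<le> norm x" by (cases "norm u0 = 0") (auto simp: mult_le_cancel_right)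
      then show ?thesis by (simp add: A2_def X2_def)
    qed
    moreover have "p \<le> 1 / 2 * X2 + A2 / 2" using cs[of 1 x u0] by (simp add: X2_def A2_def p_def)
    ultimately have pX: "p \<le> X2" by linarith
    define q where "q = \<delta> * \<eta> * (x \<bullet> v)"
    define w where "w = (norm ((\<delta> * \<eta>) *\<^sub>R v - (\<delta>\<^sup>2 / 2) *\<^sub>R u0))\<^sup>2"
    have "- q \<le> \<delta> * 1 * (1 / 2 * X2 + V2 / 2)"
    proof -
      have "\<delta> * \<eta> * \<bar>x \<bullet> v\<bar> \<le> \<delta> * 1 * (1 / 2 * X2 + V2 / 2)"
        using cs[of 1 x v] d eta0 etale by (intro mult_mono) (auto simp: X2_def V2_def)
      moreover have "- q \<le> \<delta> * \<eta> * \<bar>x \<bullet> v\<bar>"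
        using mult_left_mono[of "- (x \<bullet> v)" "\<bar>x \<bullet> v\<bar>" "\<delta> * \<eta>"] d eta0 by (simp add: q_def)
      ultimately show ?thesis by linarith
    qed
    then have "- q \<le> \<delta> * X2 / 2 + \<delta> * V2 / 2" by (simp add: algebra_simps)
    moreover have "\<delta>\<^sup>2 * p \<le> \<delta> * X2"
    proof (rule mult_mono[OF _ pX])
      show "\<delta>\<^sup>2 \<le> \<delta>" using d dle by (simp add: power2_eq_square)
    qed (use d p0 in auto)
    moreover have "Y2 = X2 + 2 * q - \<delta>\<^sup>2 * p + w"
      unfolding Y2_def X2_def p_def x1 power2_norm_eq_inner q_def w_def
      by (simp add: inner_simps inner_commute algebra_simps)
    moreover have "0 \<le> w" by (simp add: w_def)
    ultimately have "X2 - 2 * (\<delta> * X2) - \<delta> * V2 \<le> Y2" by linarith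
    then show ?thesis by (simp add: algebra_simps)
  qed
  have lin: "a1 + a2 - a3 - a5 - a6 - a4 + a7 + a8 \<le> b1 + b2 - b3 - b4 + b5 + b6 + b7 + b8"
    if "a1 \<le> b1" "a2 \<le> b2" "b3 \<le> a3" "b4 \<le> a4" "- a5 \<le> b5" "- a6 \<le> b6" "a7 \<le> b7" "a8 \<le> b8"
    for a1 a2 a3 a4 a5 a6 a7 a8 b1 b2 b3 b4 b5 b6 b7 b8 :: real
    using that by linarith
  have eq: "\<delta> * (a1 * X2 + a2 * V2 - 12 / 25 * i * (m * X2) - 12 / 25 * i * (m * ((1 - 2 * \<delta>) * X2 - \<delta> * V2)))
    = \<delta> * ((a1 - 24 / 25 * (1 - \<delta>) * (m * i)) * X2 + (a2 + 12 / 25 * \<delta> * (m * i)) * V2)" for a1 a2 i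
    by (simp add: field_simps)
  define D where "D = Y2 + 2 / \<gamma> * (x1 \<bullet> v1) + (norm v1)\<^sup>2 - (X2 + 2 / \<gamma> * (x \<bullet> v) + V2)"
  have "D \<le> \<delta> * (h / 4 * (X2 + V2)) + \<delta> * (\<gamma> * (- 3 / 2 + 9 / 4 * h)) * V2
      - \<delta> / \<gamma> * (1 - h / 2) * p - \<delta> / \<gamma> * (1 - h / 2) * s
      + \<delta> * (1 + 2 * \<delta>) * (\<gamma> / 2 * V2 + p / (2 * \<gamma>)) + \<delta> * (\<gamma> / 2 * V2 + s / (2 * \<gamma>))
      + \<delta>\<^sup>2 / 2 * p + \<delta>\<^sup>2 / 4 * (2 * p + 2 * s)"
    unfolding D_def expand by (rule lin[OF T1 T2 T3 T4 T5 T6 T7 T8])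
  also have "\<dots> = \<delta> * ((h / 4) * X2 + (h / 4 + \<gamma> * (- 1 / 2 + 9 / 4 * h + \<delta>)) * V2
      - (1 / 2 - h / 2 - \<delta> - h) / \<gamma> * p - (1 / 2 - h) / \<gamma> * s)"
    unfolding h_def using g0 by (simp add: field_simps power2_eq_square)
  \<comment> \<open>Since \<open>\<delta> \<le> h / 2\<close> and \<open>h \<le> 1 / 132\<close>,
    both brackets are at least \<open>1 / 2 - 2 * h\<close>, hence at least \<open>12 / 25\<close>.
    Only now is strong monotonicity used, at the old and at the new position.\<close>
  also have "\<dots> \<le> \<delta> * ((h / 4) * X2 + (h / 4 + \<gamma> * (- 1 / 2 + 9 / 4 * h + \<delta>)) * V2
      - (12 / 25) / \<gamma> * (m * X2) - (12 / 25) / \<gamma> * (m * ((1 - 2 * \<delta>) * X2 - \<delta> * V2)))"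
  proof -
    have "(12 / 25) / \<gamma> * (m * X2) \<le> (1 / 2 - h / 2 - \<delta> - h) / \<gamma> * p"
      using m nn d2 h132 g0 pm by (intro mult_mono divide_right_mono) auto
    moreover have "(12 / 25) / \<gamma> * (m * Y2) \<le> (1 / 2 - h) / \<gamma> * s"
      using m nn d2 h132 g0 sm by (intro mult_mono divide_right_mono) auto
    moreover have "(12 / 25) / \<gamma> * (m * ((1 - 2 * \<delta>) * X2 - \<delta> * V2)) \<le> (12 / 25) / \<gamma> * (m * Y2)"
      using m g0 Y2_ge by (intro mult_left_mono) auto
    ultimately show ?thesis using d by (intro mult_left_mono) linarith+
  qed
  also have "\<dots> = \<delta> * ((h / 4 - (24 / 25) * (1 - \<delta>) * (m / \<gamma>)) * X2
       + (h / 4 + \<gamma> * (- 1 / 2 + 9 / 4 * h + \<delta>) + (12 / 25) * \<delta> * (m / \<gamma>)) * V2)"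
  proof -
    have i: "12 / 25 / \<gamma> = 12 / 25 * (1 / \<gamma>)" "m / \<gamma> = m * (1 / \<gamma>)" by simp_all
    show ?thesis unfolding i by (rule eq)
  qed
  \<comment> \<open>For \<open>X2\<close> the time-step bound enters as
    \<open>h \<le> m / (66 * \<gamma>)\<close>, which makes the error \<open>h / 4\<close>
    negligible against \<open>m / \<gamma>\<close>. For \<open>V2\<close> almost
    \<open>\<gamma> / 2\<close> of friction is left, far more than
    \<open>m / (2 * \<gamma>)\<close>.\<close>
  also have "\<dots> \<le> \<delta> * (- (m / (2 * \<gamma>)) * X2 + - (m / (2 * \<gamma>)) * V2)"
  proof (intro mult_left_mono add_mono mult_right_mono nn)
    define k where "k = m / \<gamma>"
    have mk: "m / (2 * \<gamma>) = k / 2" by (simp add: k_def)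
    have mg0: "0 < k" using m g0 by (simp add: k_def)
    have mg1: "k \<le> 1 / 2" using frac_le[of 1 m 2 \<gamma>] m g by (simp add: k_def)
    have hg: "h \<le> k / 66"
    proof -
      have "66 * \<gamma> * h \<le> 33 * \<gamma>\<^sup>2 * h" using g h0 g0 by (simp add: power2_eq_square)
      then show ?thesis using hm g0 by (simp add: k_def field_simps)
    qed
    define t where "t = (1 - \<delta>) * k"
    have "263 / 264 * k \<le> t" unfolding t_def using dle mg0 by (intro mult_right_mono) auto
    then have "h / 4 - 24 / 25 * t \<le> - (k / 2)" using hg mg0 by linarith
    then have "h / 4 - 24 / 25 * (1 - \<delta>) * k \<le> - (k / 2)" by (simp only: t_def mult.assoc)
    then show "h / 4 - 24 / 25 * (1 - \<delta>) * (m / \<gamma>) \<le> - (m / (2 * \<gamma>))"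
      unfolding mk k_def .
    have "\<gamma> * (- 1 / 2 + 9 / 4 * h + \<delta>) \<le> \<gamma> * (- 2 / 5)"
      using h132 dle g0 by (intro mult_left_mono) auto
    moreover have "\<delta> * k \<le> 1 / 264 * (1 / 2)" using dle mg0 mg1 d by (intro mult_mono) auto
    ultimately have "h / 4 + \<gamma> * (- 1 / 2 + 9 / 4 * h + \<delta>) + 12 / 25 * \<delta> * k \<le> - (k / 2)"
      using g mg1 h132 by simp
    then show "h / 4 + \<gamma> * (- 1 / 2 + 9 / 4 * h + \<delta>) + 12 / 25 * \<delta> * (m / \<gamma>) \<le> - (m / (2 * \<gamma>))"
      unfolding mk k_def .
  qed (use d in simp)
  \<comment> \<open>Origin of the 3 in the rate: the form is at most
    \<open>3 / 2 * (X2 + V2)\<close> because \<open>2 / \<gamma> \<le> 1\<close>, so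
    \<open>m / (2 * \<gamma>)\<close> becomes \<open>m / (3 * \<gamma>)\<close>.\<close>
  also have "\<dots> = - (\<delta> * (m / (3 * \<gamma>)) * (3 / 2 * (X2 + V2)))" using g0 by (simp add: field_simps)
  also have "\<dots> \<le> - (\<delta> * (m / (3 * \<gamma>)) * (X2 + 2 / \<gamma> * (x \<bullet> v) + V2))"
  proof -
    have "2 / \<gamma> * (x \<bullet> v) \<le> 1 * (1 / 2 * X2 + V2 / 2)"
    proof -
      have "2 / \<gamma> * \<bar>x \<bullet> v\<bar> \<le> 1 * (1 / 2 * X2 + V2 / 2)"
        using cs[of 1 x v] g by (intro mult_mono) (auto simp: X2_def V2_def)
      moreover have "2 / \<gamma> * (x \<bullet> v) \<le> 2 / \<gamma> * \<bar>x \<bullet> v\<bar>"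
        using g0 by (intro mult_left_mono) auto
      ultimately show ?thesis by linarith
    qed
    then have "X2 + 2 / \<gamma> * (x \<bullet> v) + V2 \<le> 3 / 2 * (X2 + V2)" by simp
    then have "\<delta> * (m / (3 * \<gamma>)) * (X2 + 2 / \<gamma> * (x \<bullet> v) + V2) \<le> \<delta> * (m / (3 * \<gamma>)) * (3 / 2 * (X2 + V2))"
      using d m g0 by (intro mult_left_mono) auto
    then show ?thesis by linarith
  qed
  finally show ?thesis by (simp add: D_def X2_def V2_def Y2_def algebra_simps)
qed

section \<open>Convex functions with Lipschitz gradient\<close>

text \<open>Along the segment the slope of \<open>U\<close> exceeds its initial value by
  \<open>D t\<close>, which monotonicity and the Lipschitz bound enclose between 0 and
  \<open>L * t * (norm d)\<^sup>2\<close>. Subtracting the tangent, or the tangent and the quadratic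
  term, leaves a function of \<open>t\<close> that is monotone on the unit interval.\<close>

lemma convex_descent:
  fixes U :: "'a::euclidean_space \<Rightarrow> real"
  assumes D: "\<And>x. GDERIV U x :> g x"
    and L: "\<And>x y. norm (g x - g y) \<le> L * norm (x - y)"
    and mono: "\<And>x y. 0 \<le> (x - y) \<bullet> (g x - g y)"
  shows "U x + g x \<bullet> d \<le> U (x + d)" and "U (x + d) \<le> U x + g x \<bullet> d + L / 2 * (norm d)\<^sup>2"
proof -
  have der: "((\<lambda>t. U (x + t *\<^sub>R d)) has_real_derivative g (x + t *\<^sub>R d) \<bullet> d) (at t)" for t
  proof -
    have "(U has_derivative (\<lambda>h. h \<bullet> g (x + t *\<^sub>R d))) (at (x + t *\<^sub>R d))"
      using D[of "x + t *\<^sub>R d"] by (simp add: gderiv_def)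
    moreover have "((\<lambda>t. x + t *\<^sub>R d) has_derivative (\<lambda>h. h *\<^sub>R d)) (at t)"
      by (auto intro!: derivative_eq_intros)
    ultimately have "((\<lambda>t. U (x + t *\<^sub>R d)) has_derivative (\<lambda>h. (h *\<^sub>R d) \<bullet> g (x + t *\<^sub>R d))) (at t)"
      by (rule has_derivative_compose[rotated])
    then show ?thesis
      by (simp add: has_field_derivative_def inner_commute mult_commute_abs)
  qed
  define D where "D t = (g (x + t *\<^sub>R d) - g x) \<bullet> d" for t
  have D0: "0 \<le> D t" if "0 \<le> t" for t
  proof (cases "t = 0")
    case False
    then have "0 \<le> t * D t" using mono[of "x + t *\<^sub>R d" x] by (simp add: D_def inner_commute)
    then show ?thesis using False that by (simp add: zero_le_mult_iff)
  qed (simp add: D_def)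
  have D1: "D t \<le> L * t * (norm d)\<^sup>2" if "0 \<le> t" for t
  proof -
    have "D t \<le> norm (g (x + t *\<^sub>R d) - g x) * norm d" by (simp add: D_def norm_cauchy_schwarz)
    also have "\<dots> \<le> L * norm (x + t *\<^sub>R d - x) * norm d" by (intro mult_right_mono L) simp
    finally show ?thesis using that by (simp add: power2_eq_square mult_ac)
  qed
  have "(\<lambda>t. U (x + t *\<^sub>R d) - t * (g x \<bullet> d)) 0 \<le> (\<lambda>t. U (x + t *\<^sub>R d) - t * (g x \<bullet> d)) 1"
  proof (rule DERIV_nonneg_imp_nondecreasing[of 0 1])
    fix t :: real assume "0 \<le> t" "t \<le> 1"
    then show "\<exists>y. ((\<lambda>t. U (x + t *\<^sub>R d) - t * (g x \<bullet> d)) has_real_derivative y) (at t) \<and> 0 \<le> y"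
      using D0[of t] by (intro exI[of _ "D t"]) (auto intro!: derivative_eq_intros der simp: D_def inner_simps)
  qed simp
  then show "U x + g x \<bullet> d \<le> U (x + d)" by simp
  have "(\<lambda>t. U (x + t *\<^sub>R d) - t * (g x \<bullet> d) - L / 2 * t\<^sup>2 * (norm d)\<^sup>2) 1
    \<le> (\<lambda>t. U (x + t *\<^sub>R d) - t * (g x \<bullet> d) - L / 2 * t\<^sup>2 * (norm d)\<^sup>2) 0"
  proof (rule DERIV_nonpos_imp_nonincreasing[of 0 1])
    fix t :: real assume "0 \<le> t" "t \<le> 1"
    then show "\<exists>y. ((\<lambda>t. U (x + t *\<^sub>R d) - t * (g x \<bullet> d) - L / 2 * t\<^sup>2 * (norm d)\<^sup>2) has_real_derivative y) (at t) \<and> y \<le> 0"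
      using D1[of t] by (intro exI[of _ "D t - L * t * (norm d)\<^sup>2"])
        (auto intro!: derivative_eq_intros der simp: D_def inner_simps)
  qed simp
  then show "U (x + d) \<le> U x + g x \<bullet> d + L / 2 * (norm d)\<^sup>2" by simp
qed

text \<open>The Baillon-Haddad inequality. An auxiliary point \<open>z\<close> is bounded from below
  by the tangent at \<open>x\<close> and from above by the quadratic bound at \<open>y\<close>;
  adding the result to the one with \<open>x\<close> and \<open>y\<close> exchanged eliminates the
  values of \<open>U\<close>.\<close>

lemma gradient_cocoercive:
  fixes U :: "'a::euclidean_space \<Rightarrow> real"
  assumes D: "\<And>x. GDERIV U x :> g x" and L0: "0 < L"
    and L: "\<And>x y. norm (g x - g y) \<le> L * norm (x - y)"
    and mono: "\<And>x y. 0 \<le> (x - y) \<bullet> (g x - g y)"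
  shows "(norm (g x - g y))\<^sup>2 \<le> L * ((x - y) \<bullet> (g x - g y))"
proof -
  have key: "U x - U y \<le> g x \<bullet> (x - y) - (norm (g x - g y))\<^sup>2 / (2 * L)" for x y
  proof -
    define w where "w = g y - g x"
    \<comment> \<open>This point minimises the quadratic upper bound at \<open>y\<close> minus the
      tangent at \<open>x\<close>, so it gives the sharpest comparison of the two.\<close>
    define z where "z = y - (1 / L) *\<^sub>R w"
    define a where "a = (g x \<bullet> w) / L"
    define b where "b = (g y \<bullet> w) / L"
    have "g x \<bullet> (z - x) = - (g x \<bullet> (x - y)) - a"
      by (simp add: z_def a_def inner_simps)
    then have "U x - g x \<bullet> (x - y) - a \<le> U z"
      using convex_descent(1)[OF D L mono, of x "z - x"] by simp
    moreover have n: "L / 2 * (norm ((1 / L) *\<^sub>R w))\<^sup>2 = (b - a) / 2"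
      using L0 unfolding power2_norm_eq_inner a_def b_def w_def
      by (simp add: inner_simps inner_commute field_simps)
    have "U z \<le> U y + g y \<bullet> (- ((1 / L) *\<^sub>R w)) + L / 2 * (norm (- ((1 / L) *\<^sub>R w)))\<^sup>2"
      using convex_descent(2)[OF D L mono, of y "- ((1 / L) *\<^sub>R w)"] by (simp add: z_def)
    then have "U z \<le> U y - b + (b - a) / 2"
      unfolding norm_minus_cancel n by (simp add: b_def)
    ultimately have "U x - U y \<le> g x \<bullet> (x - y) - (b - a) / 2" by (simp add: field_simps)
    moreover have "(norm (g x - g y))\<^sup>2 / (2 * L) = (b - a) / 2"
      unfolding power2_norm_eq_inner a_def b_def w_def using L0
      by (simp add: inner_simps inner_commute field_simps)
    ultimately show ?thesis by (simp only:)
  qed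
  have "0 \<le> (x - y) \<bullet> (g x - g y) - (norm (g x - g y))\<^sup>2 / L"
    using key[of x y] key[of y x] by (simp add: norm_minus_commute inner_simps inner_commute field_simps)
  then show ?thesis using L0 by (simp add: field_simps)
qed

subsection \<open>Random contractions\<close>

lemma emeasure_distr_nn_integral:
  assumes "f \<in> N \<rightarrow>\<^sub>M K" and "A \<in> sets K"
  shows "emeasure (distr N K f) A = (\<integral>\<^sup>+ x. indicator A (f x) \<partial>N)"
proof -
  have "emeasure (distr N K f) A = (\<integral>\<^sup>+ y. indicator A y \<partial>distr N K f)" using assms by simp
  also have "\<dots> = (\<integral>\<^sup>+ x. indicator A (f x) \<partial>N)" using assms by (intro nn_integral_distr) auto
  finally show ?thesis .
qed

lemma sets_coupling:
  "\<rho> \<in> couplings \<nu> \<mu> \<Longrightarrow> sets \<rho> = sets (borel \<Otimes>\<^sub>M borel)"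
  unfolding borel_prod by (simp add: couplings_def borel_prob_def)

text \<open>One random map per step, contracting path by path. The contraction is stated for a gauge
  \<open>q\<close> comparable with the norm, so that the comparison constant \<open>b / a\<close> is
  paid once and not at every step.\<close>

locale random_contraction = prob_space M for M :: "'n measure" +
  fixes F :: "'z::euclidean_space \<Rightarrow> 'n \<Rightarrow> 'z" and q :: "'z \<Rightarrow> real" and r a b :: real
  assumes F_measurable: "(\<lambda>(z, \<xi>). F z \<xi>) \<in> borel \<Otimes>\<^sub>M M \<rightarrow>\<^sub>M borel"
    and q_measurable: "q \<in> borel_measurable borel"
    and q_triangle: "\<And>x y. q (x + y) \<le> q x + q y"
    and q_lower: "\<And>z. a * norm z \<le> q z"
    and q_upper: "\<And>z. q z \<le> b * norm z"
    and a_pos: "0 < a"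
    and r_bounds: "0 < r" "r < 1"
    and contraction: "\<And>\<xi> z z'. \<xi> \<in> space M \<Longrightarrow> q (F z \<xi> - F z' \<xi>) \<le> r * q (z - z')"
begin

lemma F_measurable' [measurable (raw)]:
  assumes [measurable]: "f \<in> N \<rightarrow>\<^sub>M borel" "g \<in> N \<rightarrow>\<^sub>M M"
  shows "(\<lambda>x. F (f x) (g x)) \<in> N \<rightarrow>\<^sub>M borel"
  using measurable_compose[OF _ F_measurable, of "\<lambda>x. (f x, g x)" N] by simp

lemma q_measurable' [measurable]: "q \<in> borel_measurable borel"
  by (rule q_measurable)

lemma q_nonneg: "0 \<le> q z"
  using q_lower[of z] a_pos by (smt (verit) mult_nonneg_nonneg norm_ge_zero)

lemma q_zero: "q 0 = 0"
  using q_nonneg[of 0] q_upper[of 0] by simp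

lemma norm_le_q: "norm z \<le> q z / a"
  using q_lower[of z] a_pos by (simp add: field_simps)

text \<open>The contraction of \<open>q\<close> becomes a Lipschitz bound for the norm whose
  constant \<open>r * b / a\<close> may exceed 1; continuity is all that is extracted from it, to
  pass limits through the random map.\<close>

lemma isCont_F:
  assumes "\<xi> \<in> space M"
  shows "isCont (\<lambda>z. F z \<xi>) z"
proof -
  have "norm (F z' \<xi> - F z \<xi>) \<le> r * b / a * norm (z' - z)" for z'
  proof -
    have "norm (F z' \<xi> - F z \<xi>) \<le> q (F z' \<xi> - F z \<xi>) / a" by (rule norm_le_q)
    also have "\<dots> \<le> r * (b * norm (z' - z)) / a"
      using contraction[OF assms, of z' z] q_upper[of "z' - z"] r_bounds a_pos
      by (intro divide_right_mono order_trans[OF contraction[OF assms]] mult_left_mono) auto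
    finally show ?thesis by simp
  qed
  then have le: "\<forall>\<^sub>F z' in at z. norm (F z' \<xi> - F z \<xi>) \<le> r * b / a * norm (z' - z)" by simp
  have "((\<lambda>z'. r * b / a * norm (z' - z)) \<longlongrightarrow> r * b / a * norm (z - z)) (at z)"
    by (intro tendsto_intros)
  then have "((\<lambda>z'. r * b / a * norm (z' - z)) \<longlongrightarrow> 0) (at z)" by simp
  then have "((\<lambda>z'. F z' \<xi> - F z \<xi>) \<longlongrightarrow> 0) (at z)"
    by (rule Lim_null_comparison[OF le])
  then show ?thesis unfolding isCont_def by (rule LIM_zero_cancel)
qed

section \<open>Synchronous coupling of two copies\<close>

text \<open>Encoded as an image of a product measure rather than as a bind: the noise stays visible
  and can be fed to both components of a coupling. \<open>obabo_eq_distr\<close> links this to the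
  kernel.\<close>

definition push :: "'z measure \<Rightarrow> 'z measure" where
  "push \<nu> = distr (\<nu> \<Otimes>\<^sub>M M) borel (\<lambda>(z, \<xi>). F z \<xi>)"

definition push2 :: "('z \<times> 'z) measure \<Rightarrow> ('z \<times> 'z) measure" where
  "push2 \<rho> = distr (\<rho> \<Otimes>\<^sub>M M) borel (\<lambda>w. (F (fst (fst w)) (snd w), F (snd (fst w)) (snd w)))"

text \<open>If the state is realised as a random variable \<open>f\<close> on \<open>N\<close>, the
  next state is realised on the product with fresh noise. This yields the marginals of
  \<open>push2\<close> and the invariance of the limit law.\<close>

lemma push_distr:
  assumes f [measurable]: "f \<in> N \<rightarrow>\<^sub>M borel" and "prob_space N"
  shows "push (distr N borel f) = distr (N \<Otimes>\<^sub>M M) borel (\<lambda>(x, \<xi>). F (f x) \<xi>)"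
proof -
  have "distr N borel f \<Otimes>\<^sub>M M = distr N borel f \<Otimes>\<^sub>M distr M M (\<lambda>x. x)"
    by simp
  also have "\<dots> = distr (N \<Otimes>\<^sub>M M) (borel \<Otimes>\<^sub>M M) (\<lambda>(x, \<xi>). (f x, \<xi>))"
    by (rule pair_measure_distr) (auto simp: sigma_finite_measure_axioms)
  finally have eq: "distr N borel f \<Otimes>\<^sub>M M = distr (N \<Otimes>\<^sub>M M) (borel \<Otimes>\<^sub>M M) (\<lambda>(x, \<xi>). (f x, \<xi>))" .
  show ?thesis
    unfolding push_def eq by (subst distr_distr) (auto simp: comp_def case_prod_beta intro!: distr_cong)
qed

lemma push_borel_prob:
  assumes "\<nu> \<in> borel_prob"
  shows "push \<nu> \<in> borel_prob"
proof -
  interpret \<nu>: prob_space \<nu> using assms by (simp add: borel_prob_def)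
  interpret P: pair_prob_space \<nu> M ..
  have "sets (\<nu> \<Otimes>\<^sub>M M) = sets (borel \<Otimes>\<^sub>M M)"
    using assms by (intro sets_pair_measure_cong) (simp_all add: borel_prob_def)
  then have "(\<lambda>(z, \<xi>). F z \<xi>) \<in> \<nu> \<Otimes>\<^sub>M M \<rightarrow>\<^sub>M borel"
    using F_measurable measurable_cong_sets[OF _ refl] by blast
  then show ?thesis
    using P.prob_space_distr by (simp add: push_def borel_prob_def)
qed

lemma push2_map_measurable:
  assumes "sets \<rho> = sets borel"
  shows "(\<lambda>w. (F (fst (fst w)) (snd w), F (snd (fst w)) (snd w))) \<in> \<rho> \<Otimes>\<^sub>M M \<rightarrow>\<^sub>M borel"
proof -
  have "(\<lambda>w. (F (fst (fst w)) (snd w), F (snd (fst w)) (snd w))) \<in> (borel \<Otimes>\<^sub>M borel) \<Otimes>\<^sub>M M \<rightarrow>\<^sub>M borel \<Otimes>\<^sub>M borel"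
    by measurable
  moreover have "sets (\<rho> \<Otimes>\<^sub>M M) = sets ((borel \<Otimes>\<^sub>M borel) \<Otimes>\<^sub>M M)"
    by (intro sets_pair_measure_cong) (simp_all only: assms borel_prod)
  ultimately show ?thesis using measurable_cong_sets[OF _ refl] unfolding borel_prod by blast
qed

lemma push2_couplings:
  assumes "\<rho> \<in> couplings \<nu> \<mu>"
  shows "push2 \<rho> \<in> couplings (push \<nu>) (push \<mu>)"
proof -
  have \<rho>: "prob_space \<rho>" and s: "sets \<rho> = sets borel"
    and \<nu>: "\<nu> = distr \<rho> borel fst" and \<mu>: "\<mu> = distr \<rho> borel snd"
    using assms by (auto simp: couplings_def borel_prob_def)
  interpret \<rho>: prob_space \<rho> by fact
  interpret P: pair_prob_space \<rho> M ..
  note m = push2_map_measurable[OF s]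
  have fs: "fst \<in> \<rho> \<rightarrow>\<^sub>M borel" "snd \<in> \<rho> \<rightarrow>\<^sub>M borel"
    using borel_measurable_continuous_onI[OF continuous_on_fst[OF continuous_on_id]]
      borel_measurable_continuous_onI[OF continuous_on_snd[OF continuous_on_id]]
    by (simp_all add: measurable_cong_sets[OF s refl])
  have fs': "fst \<in> (borel :: ('z \<times> 'z) measure) \<rightarrow>\<^sub>M borel" "snd \<in> (borel :: ('z \<times> 'z) measure) \<rightarrow>\<^sub>M borel"
    using fs by (simp_all only: measurable_cong_sets[OF s refl])
  have "distr (push2 \<rho>) borel fst = push \<nu>"
    unfolding \<nu> push2_def push_distr[OF fs(1) \<rho>] distr_distr[OF fs'(1) m]
    by (rule distr_cong) auto
  moreover have "distr (push2 \<rho>) borel snd = push \<mu>"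
    unfolding \<mu> push2_def push_distr[OF fs(2) \<rho>] distr_distr[OF fs'(2) m]
    by (rule distr_cong) auto
  moreover have "push2 \<rho> \<in> borel_prob"
    using P.prob_space_distr[OF m] by (simp add: borel_prob_def push2_def)
  ultimately show ?thesis by (simp add: couplings_def)
qed

text \<open>An arbitrary monotone \<open>g\<close> serves two purposes: a power gives the
  Wasserstein bound, and the indicator of a half-line gives uniqueness without any moment.\<close>

lemma nn_integral_push2_le:
  assumes \<rho>: "\<rho> \<in> couplings \<nu> \<mu>"
    and g: "mono g" and gm: "g \<in> borel_measurable borel"
  shows "(\<integral>\<^sup>+ w. g (q (fst w - snd w)) \<partial>push2 \<rho>) \<le> (\<integral>\<^sup>+ w. g (r * q (fst w - snd w)) \<partial>\<rho>)"
proof -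
  have s: "sets \<rho> = sets borel"
    using \<rho> by (simp add: couplings_def borel_prob_def)
  have q_diff: "(\<lambda>w. q (fst w - snd w)) \<in> borel_measurable (borel :: ('z \<times> 'z) measure)"
    unfolding borel_prod[symmetric] by measurable
  have gq: "(\<lambda>w. g (c * q (fst w - snd w))) \<in> borel_measurable (borel :: ('z \<times> 'z) measure)" for c
    by (rule measurable_compose[OF _ gm]) (intro borel_measurable_times borel_measurable_const q_diff)
  have rho_eq: "(\<lambda>w. g (r * q (fst w - snd w))) \<in> borel_measurable \<rho>"
    using gq by (simp only: measurable_cong_sets[OF s refl])
  have "(\<integral>\<^sup>+ w. g (q (fst w - snd w)) \<partial>push2 \<rho>)
      = (\<integral>\<^sup>+ w. g (q (F (fst (fst w)) (snd w) - F (snd (fst w)) (snd w))) \<partial>(\<rho> \<Otimes>\<^sub>M M))"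
    unfolding push2_def using gq[of 1] push2_map_measurable[OF s]
    by (subst nn_integral_distr) (simp_all add: case_prod_beta)
  also have "\<dots> \<le> (\<integral>\<^sup>+ w. g (r * q (fst (fst w) - snd (fst w))) \<partial>(\<rho> \<Otimes>\<^sub>M M))"
  proof (rule nn_integral_mono)
    fix w assume "w \<in> space (\<rho> \<Otimes>\<^sub>M M)"
    then have "snd w \<in> space M" by (auto simp: space_pair_measure)
    then show "g (q (F (fst (fst w)) (snd w) - F (snd (fst w)) (snd w))) \<le> g (r * q (fst (fst w) - snd (fst w)))"
      by (rule monoD[OF g contraction])
  qed
  also have "\<dots> = (\<integral>\<^sup>+ w. (\<integral>\<^sup>+ \<xi>. g (r * q (fst w - snd w)) \<partial>M) \<partial>\<rho>)"
    using measurable_compose[OF measurable_fst rho_eq] by (subst nn_integral_fst[symmetric]) simp_all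
  also have "\<dots> = (\<integral>\<^sup>+ w. g (r * q (fst w - snd w)) \<partial>\<rho>)"
    by (simp add: emeasure_space_1)
  finally show ?thesis .
qed

lemma push2_iterate_couplings:
  assumes "\<rho> \<in> couplings \<nu> \<mu>"
  shows "(push2 ^^ n) \<rho> \<in> couplings ((push ^^ n) \<nu>) ((push ^^ n) \<mu>)"
  by (induction n) (simp_all add: assms push2_couplings)

lemma nn_integral_push2_iterate_le:
  assumes \<rho>: "\<rho> \<in> couplings \<nu> \<mu>" and "mono g" and "g \<in> borel_measurable borel"
  shows "(\<integral>\<^sup>+ w. g (q (fst w - snd w)) \<partial>(push2 ^^ n) \<rho>) \<le> (\<integral>\<^sup>+ w. g (r ^ n * q (fst w - snd w)) \<partial>\<rho>)"
  using assms(2,3)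
proof (induction n arbitrary: g)
  case (Suc n)
  note g = Suc.prems
  have "(\<lambda>t. g (r * t)) \<in> borel_measurable borel"
    by (rule measurable_compose[OF _ g(2)]) simp
  moreover have "mono (\<lambda>t. g (r * t))"
    using r_bounds by (auto intro!: monoI monoD[OF g(1)] mult_left_mono)
  ultimately have "(\<integral>\<^sup>+ w. g (r * q (fst w - snd w)) \<partial>(push2 ^^ n) \<rho>)
      \<le> (\<integral>\<^sup>+ w. g (r * (r ^ n * q (fst w - snd w))) \<partial>\<rho>)"
    by (rule Suc.IH[rotated])
  with nn_integral_push2_le[OF push2_iterate_couplings[OF \<rho>] g, of n]
  have "(\<integral>\<^sup>+ w. g (q (fst w - snd w)) \<partial>push2 ((push2 ^^ n) \<rho>))
      \<le> (\<integral>\<^sup>+ w. g (r * (r ^ n * q (fst w - snd w))) \<partial>\<rho>)"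
    by (rule order_trans)
  then show ?case by (simp add: mult.assoc)
qed simp

section \<open>Uniqueness of the invariant law\<close>

text \<open>The product coupling always exists, and by invariance its images under
  \<open>push2\<close> keep the same marginals. If one copy lies in \<open>C\<close>, the other is
  within \<epsilon> of \<open>C\<close> unless the copies are far apart, an event whose probability
  vanishes as \<open>n\<close> grows. Then \<epsilon> tends to 0, and closedness of \<open>C\<close>
  recovers \<open>C\<close> from its neighbourhoods.\<close>

lemma emeasure_closed_le_of_invariant:
  assumes \<pi>: "\<pi> \<in> borel_prob" "push \<pi> = \<pi>" and \<pi>': "\<pi>' \<in> borel_prob" "push \<pi>' = \<pi>'" and C: "closed C"
  shows "emeasure \<pi> C \<le> emeasure \<pi>' C"
\<comment> \<open>\<open>infdist\<close> to the empty set is 0 by convention, so the neighbourhoods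
  \<open>N\<close> would not shrink to \<open>C\<close>.\<close>
proof (cases "C = {}")
  case False
  interpret \<pi>: prob_space \<pi> using \<pi> by (simp add: borel_prob_def)
  interpret \<pi>': prob_space \<pi>' using \<pi>' by (simp add: borel_prob_def)
  interpret P: pair_prob_space \<pi> \<pi>' ..
  have s [measurable_cong]: "sets \<pi> = sets borel" "sets \<pi>' = sets borel"
    using \<pi> \<pi>' by (simp_all add: borel_prob_def)
  define \<rho> where "\<rho> = \<pi> \<Otimes>\<^sub>M \<pi>'"
  have s\<rho>: "sets \<rho> = sets borel"
    unfolding \<rho>_def borel_prod[symmetric] by (intro sets_pair_measure_cong s)
  have "distr \<rho> borel fst = \<pi>"
  proof -
    have "distr \<rho> borel fst = distr \<rho> \<pi> fst" by (rule distr_cong) (simp_all add: s)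
    then show ?thesis by (simp add: \<rho>_def \<pi>'.distr_pair_fst)
  qed
  moreover have "distr \<rho> borel snd = \<pi>'"
  proof (rule measure_eqI)
    fix A assume "A \<in> sets (distr \<rho> borel snd)"
    then have A: "A \<in> sets \<pi>'" by (simp add: s)
    then have "emeasure (distr \<rho> borel snd) A = emeasure \<rho> (space \<pi> \<times> A)"
      unfolding \<rho>_def using sets.sets_into_space[OF A] by (subst emeasure_distr)
        (auto simp: s space_pair_measure intro!: arg_cong[where f="emeasure _"])
    also have "\<dots> = emeasure \<pi>' A"
      unfolding \<rho>_def using A by (subst \<pi>'.emeasure_pair_measure_Times) (auto simp: \<pi>.emeasure_space_1)
    finally show "emeasure (distr \<rho> borel snd) A = emeasure \<pi>' A" .
  qed (simp add: s)
  ultimately have \<rho>: "\<rho> \<in> couplings \<pi> \<pi>'"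
    using s\<rho> P.prob_space_axioms by (simp add: couplings_def borel_prob_def \<rho>_def)
  have fixed: "(push ^^ n) \<pi> = \<pi>" "(push ^^ n) \<pi>' = \<pi>'" for n
    by (induction n) (simp_all add: \<pi> \<pi>')
  have C_sets [measurable]: "C \<in> sets borel" using C by simp
  define N where "N \<epsilon> = {z. infdist z C \<le> \<epsilon>}" for \<epsilon> :: real
  have N_sets [measurable]: "N \<epsilon> \<in> sets borel" for \<epsilon>
    unfolding N_def by (intro borel_closed closed_Collect_le continuous_intros)
  have fattening: "emeasure \<pi> C \<le> emeasure \<pi>' (N \<epsilon>)" if "0 < \<epsilon>" for \<epsilon>
  proof -
    \<comment> \<open>The threshold is chosen by \<open>q_lower\<close>: a distance above \<epsilon>
      forces \<open>q\<close> to reach \<open>a * \<epsilon>\<close>. For fixed \<open>w\<close> the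
      argument \<open>r ^ n * q (fst w - snd w)\<close> eventually falls below it, and the constant
      1 dominates.\<close>
    define g :: "real \<Rightarrow> ennreal" where "g = indicator {a * \<epsilon> ..}"
    have g: "mono g" "g \<in> borel_measurable borel"
      unfolding g_def by (auto simp: mono_def split: split_indicator)
    note [measurable] = g(2)
    have le: "emeasure \<pi> C \<le> emeasure \<pi>' (N \<epsilon>) + (\<integral>\<^sup>+ w. g (r ^ n * q (fst w - snd w)) \<partial>\<rho>)" for n
    proof -
      define \<sigma> where "\<sigma> = (push2 ^^ n) \<rho>"
      have \<sigma>: "\<sigma> \<in> couplings \<pi> \<pi>'" using push2_iterate_couplings[OF \<rho>, of n] by (simp add: \<sigma>_def fixed)
      then have fs: "\<pi> = distr \<sigma> borel fst" "\<pi>' = distr \<sigma> borel snd"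
        by (simp_all add: couplings_def)
      have s\<sigma>: "sets \<sigma> = sets (borel \<Otimes>\<^sub>M borel)"
        using \<sigma> by (intro sets_coupling)
      note [measurable_cong] = s\<sigma>
      have "emeasure \<pi> C = (\<integral>\<^sup>+ w. indicator C (fst w) \<partial>\<sigma>)"
        unfolding fs(1) by (rule emeasure_distr_nn_integral) measurable
      also have "\<dots> \<le> (\<integral>\<^sup>+ w. indicator (N \<epsilon>) (snd w) + g (q (fst w - snd w)) \<partial>\<sigma>)"
      proof (rule nn_integral_mono)
        fix w :: "'z \<times> 'z"
        have "snd w \<in> N \<epsilon> \<or> a * \<epsilon> \<le> q (fst w - snd w)" if "fst w \<in> C"
        proof (cases "dist (snd w) (fst w) \<le> \<epsilon>")
          case True
          then show ?thesis using infdist_le[OF that, of "snd w"] by (simp add: N_def)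
        next
          case False
          then have "a * \<epsilon> \<le> a * norm (fst w - snd w)"
            using a_pos by (simp add: dist_norm norm_minus_commute)
          then show ?thesis using q_lower[of "fst w - snd w"] by linarith
        qed
        then show "indicator C (fst w) \<le> indicator (N \<epsilon>) (snd w) + g (q (fst w - snd w))"
          unfolding g_def by (auto split: split_indicator)
      qed
      also have "\<dots> = (\<integral>\<^sup>+ w. indicator (N \<epsilon>) (snd w) \<partial>\<sigma>) + (\<integral>\<^sup>+ w. g (q (fst w - snd w)) \<partial>\<sigma>)"
        by (rule nn_integral_add) measurable
      also have "(\<integral>\<^sup>+ w. indicator (N \<epsilon>) (snd w) \<partial>\<sigma>) = emeasure \<pi>' (N \<epsilon>)"
        unfolding fs(2) by (rule emeasure_distr_nn_integral[symmetric]) measurable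
      also have "(\<integral>\<^sup>+ w. g (q (fst w - snd w)) \<partial>\<sigma>) \<le> (\<integral>\<^sup>+ w. g (r ^ n * q (fst w - snd w)) \<partial>\<rho>)"
        unfolding \<sigma>_def by (rule nn_integral_push2_iterate_le[OF \<rho> g])
      finally show ?thesis by (simp add: add_left_mono)
    qed
    have [measurable_cong]: "sets \<rho> = sets (borel \<Otimes>\<^sub>M borel)" by (rule sets_coupling[OF \<rho>])
    have "(\<lambda>n. \<integral>\<^sup>+ w. g (r ^ n * q (fst w - snd w)) \<partial>\<rho>) \<longlonglongrightarrow> (\<integral>\<^sup>+ w. 0 \<partial>\<rho>)"
    proof (rule nn_integral_dominated_convergence[where w="\<lambda>_. 1"])
      show "AE w in \<rho>. (\<lambda>n. g (r ^ n * q (fst w - snd w))) \<longlonglongrightarrow> 0"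
      proof (rule AE_I2)
        fix w :: "'z \<times> 'z"
        have "(\<lambda>n. r ^ n * q (fst w - snd w)) \<longlonglongrightarrow> 0 * q (fst w - snd w)"
          using r_bounds by (intro tendsto_intros LIMSEQ_power_zero) auto
        then have "\<forall>\<^sub>F n in sequentially. r ^ n * q (fst w - snd w) < a * \<epsilon>"
          using a_pos \<open>0 < \<epsilon>\<close> by (intro order_tendstoD) auto
        then have "\<forall>\<^sub>F n in sequentially. g (r ^ n * q (fst w - snd w)) = 0"
          by eventually_elim (auto simp: g_def)
        then show "(\<lambda>n. g (r ^ n * q (fst w - snd w))) \<longlonglongrightarrow> 0" by (rule tendsto_eventually)
      qed
      show "AE w in \<rho>. g (r ^ n * q (fst w - snd w)) \<le> 1" for n
        by (auto simp: g_def split: split_indicator)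
      show "(\<integral>\<^sup>+ w. 1 \<partial>\<rho>) < \<infinity>" using P.emeasure_space_1 by (simp add: \<rho>_def)
    qed auto
    then have "(\<lambda>n. emeasure \<pi>' (N \<epsilon>) + (\<integral>\<^sup>+ w. g (r ^ n * q (fst w - snd w)) \<partial>\<rho>)) \<longlonglongrightarrow> emeasure \<pi>' (N \<epsilon>) + 0"
      by (intro tendsto_intros) simp
    then show ?thesis
      using le by (intro LIMSEQ_le_const[where X="\<lambda>n. emeasure \<pi>' (N \<epsilon>) + (\<integral>\<^sup>+ w. g (r ^ n * q (fst w - snd w)) \<partial>\<rho>)"]) auto
  qed
  have "(\<lambda>k. emeasure \<pi>' (N (1 / real (Suc k)))) \<longlonglongrightarrow> emeasure \<pi>' (\<Inter>k. N (1 / real (Suc k)))"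
  proof (rule Lim_emeasure_decseq)
    show "decseq (\<lambda>k. N (1 / real (Suc k)))"
    proof (unfold decseq_def, intro allI impI)
      fix m n :: nat assume "m \<le> n"
      then have "1 / real (Suc n) \<le> 1 / real (Suc m)" by (simp add: frac_le)
      then show "N (1 / real (Suc n)) \<subseteq> N (1 / real (Suc m))" by (auto simp: N_def simp del: of_nat_Suc)
    qed
  qed (auto simp: s)
  moreover have "(\<Inter>k. N (1 / real (Suc k))) = C"
  proof (intro equalityI subsetI)
    fix z assume "z \<in> (\<Inter>k. N (1 / real (Suc k)))"
    then have "infdist z C \<le> 1 / real (Suc k)" for k by (auto simp: N_def)
    then have "infdist z C \<le> 0"
      using LIMSEQ_inverse_real_of_nat by (intro LIMSEQ_le_const[where X="\<lambda>k. inverse (real (Suc k))"]) (auto simp: inverse_eq_divide)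
    then show "z \<in> C"
      using in_closed_iff_infdist_zero[OF C False] infdist_nonneg[of z C] by force
  qed (auto simp: N_def)
  ultimately show ?thesis
    using fattening by (intro LIMSEQ_le_const[where X="\<lambda>k. emeasure \<pi>' (N (1 / real (Suc k)))"]) simp_all
qed simp

lemma invariant_unique:
  assumes "\<pi> \<in> borel_prob" "push \<pi> = \<pi>" "\<pi>' \<in> borel_prob" "push \<pi>' = \<pi>'"
  shows "\<pi> = \<pi>'"
proof (rule measure_eqI_generator_eq[where E="Collect closed" and \<Omega>=UNIV and A="\<lambda>_. UNIV"])
  interpret \<pi>: prob_space \<pi> using assms by (simp add: borel_prob_def)
  show "Int_stable (Collect closed :: 'z set set)" by (auto simp: Int_stable_def)
  show "emeasure \<pi> C = emeasure \<pi>' C" if "C \<in> Collect closed" for C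
    using that assms by (intro antisym emeasure_closed_le_of_invariant) auto
  have "sets borel = sigma_sets UNIV (Collect closed :: 'z set set)"
    unfolding borel_eq_closed by (rule sets_measure_of) simp
  then show "sets \<pi> = sigma_sets UNIV (Collect closed)" "sets \<pi>' = sigma_sets UNIV (Collect closed)"
    using assms by (simp_all add: borel_prob_def)
  show "emeasure \<pi> UNIV \<noteq> \<infinity>" by simp
qed auto

text \<open>Letac's principle: composing the random maps in the reversed order makes the iterates converge
  almost surely, and the limit is shift-equivariant.\<close>

primrec backward :: "nat \<Rightarrow> 'n stream \<Rightarrow> 'z" where
  "backward 0 \<omega> = 0"
| "backward (Suc n) \<omega> = F (backward n (stl \<omega>)) (shd \<omega>)"

abbreviation S :: "'n stream measure" where "S \<equiv> stream_space M"

lemma backward_measurable [measurable]: "backward n \<in> S \<rightarrow>\<^sub>M borel"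
proof (induction n)
  case (Suc n)
  note Suc [measurable]
  show ?case by simp
qed simp

text \<open>In the reversed order both iterates share their \<open>n\<close> outermost maps and
  differ only innermost, where one starts at 0 and the other at \<open>F 0 (\<omega> !! n)\<close>.
  Each shared map contributes a factor \<open>r\<close>.\<close>

lemma backward_increment:
  assumes "\<omega> \<in> streams (space M)"
  shows "q (backward (Suc n) \<omega> - backward n \<omega>) \<le> r ^ n * q (F 0 (\<omega> !! n))"
  using assms
proof (induction n arbitrary: \<omega>)
  case (Suc n)
  from Suc.prems have "shd \<omega> \<in> space M" "stl \<omega> \<in> streams (space M)" by (auto simp: streams_shd streams_stl)
  then have "q (backward (Suc (Suc n)) \<omega> - backward (Suc n) \<omega>) \<le> r * q (backward (Suc n) (stl \<omega>) - backward n (stl \<omega>))"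
    by (simp add: contraction)
  also have "\<dots> \<le> r * (r ^ n * q (F 0 (stl \<omega> !! n)))"
    using Suc.IH[OF \<open>stl \<omega> \<in> _\<close>] r_bounds by (intro mult_left_mono) auto
  finally show ?case by simp
qed simp

lemma nn_integral_snth:
  assumes [measurable]: "h \<in> borel_measurable M"
  shows "(\<integral>\<^sup>+ \<omega>. h (\<omega> !! n) \<partial>S) = (\<integral>\<^sup>+ \<xi>. h \<xi> \<partial>M)"
proof (induction n)
  interpret S: prob_space S by (rule prob_space_stream_space)
  case 0
  show ?case by (subst nn_integral_stream_space) (simp_all add: S.emeasure_space_1)
next
  case (Suc n)
  show ?case by (subst nn_integral_stream_space) (simp_all add: Suc emeasure_space_1)
qed

text \<open>The increments are dominated by a series whose expectation is geometric. It is therefore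
  almost surely finite, and the iterates converge as partial sums of an absolutely convergent
  series.\<close>

lemma backward_convergent:
  assumes "(\<integral>\<^sup>+ \<xi>. ennreal (q (F 0 \<xi>)) \<partial>M) < \<infinity>"
  shows "AE \<omega> in S. convergent (\<lambda>n. backward n \<omega>)"
proof -
  obtain c where c: "(\<integral>\<^sup>+ \<xi>. ennreal (q (F 0 \<xi>)) \<partial>M) = ennreal c" "0 \<le> c"
    using assms by (cases "\<integral>\<^sup>+ \<xi>. ennreal (q (F 0 \<xi>)) \<partial>M") auto
  have "(\<integral>\<^sup>+ \<omega>. (\<Sum>n. ennreal (r ^ n * q (F 0 (\<omega> !! n)))) \<partial>S) = (\<Sum>n. ennreal (r ^ n * c))"
  proof (subst nn_integral_suminf)
    have "(\<integral>\<^sup>+ \<omega>. ennreal (r ^ n * q (F 0 (\<omega> !! n))) \<partial>S) = ennreal (r ^ n * c)" for n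
    proof -
      have "(\<integral>\<^sup>+ \<omega>. ennreal (r ^ n * q (F 0 (\<omega> !! n))) \<partial>S) = (\<integral>\<^sup>+ \<xi>. ennreal (r ^ n * q (F 0 \<xi>)) \<partial>M)"
        by (rule nn_integral_snth) simp
      also have "\<dots> = ennreal (r ^ n * c)"
        using r_bounds by (simp add: ennreal_mult' nn_integral_cmult c)
      finally show ?thesis .
    qed
    then show "(\<Sum>n. \<integral>\<^sup>+ \<omega>. ennreal (r ^ n * q (F 0 (\<omega> !! n))) \<partial>S) = (\<Sum>n. ennreal (r ^ n * c))" by simp
  qed measurable
  also have "\<dots> = ennreal (\<Sum>n. r ^ n * c)"
    using r_bounds c by (intro suminf_ennreal2 summable_mult2 summable_geometric) auto
  finally have "AE \<omega> in S. (\<Sum>n. ennreal (r ^ n * q (F 0 (\<omega> !! n)))) \<noteq> \<infinity>"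
    by (intro nn_integral_noteq_infinite) auto
  then show ?thesis
  proof (rule AE_mp, intro AE_I2 impI)
    fix \<omega> assume \<omega>: "\<omega> \<in> space S" and fin: "(\<Sum>n. ennreal (r ^ n * q (F 0 (\<omega> !! n)))) \<noteq> \<infinity>"
    have "summable (\<lambda>n. r ^ n * q (F 0 (\<omega> !! n)))"
      using fin r_bounds q_nonneg by (intro summable_suminf_not_top) auto
    then have "summable (\<lambda>n. r ^ n * q (F 0 (\<omega> !! n)) / a)" by (rule summable_divide)
    then have "summable (\<lambda>n. backward (Suc n) \<omega> - backward n \<omega>)"
    proof (rule summable_comparison_test'[where N=0])
      fix n
      have "norm (backward (Suc n) \<omega> - backward n \<omega>) \<le> q (backward (Suc n) \<omega> - backward n \<omega>) / a"
        by (rule norm_le_q)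
      also have "\<dots> \<le> r ^ n * q (F 0 (\<omega> !! n)) / a"
        using backward_increment[of \<omega> n] \<omega> a_pos by (intro divide_right_mono) (auto simp: space_stream_space)
      finally show "norm (backward (Suc n) \<omega> - backward n \<omega>) \<le> r ^ n * q (F 0 (\<omega> !! n)) / a" .
    qed
    then show "convergent (\<lambda>n. backward n \<omega>)"
      unfolding summable_iff_convergent sum_lessThan_telescope[of "\<lambda>n. backward n \<omega>"] by simp
  qed
qed

text \<open>Where the iterates diverge, \<open>lim\<close> is an unspecified value; this is a null
  set as soon as \<open>q (F 0 \<xi>)\<close> has finite mean.\<close>

definition limit_law :: "'z measure" where
  "limit_law = distr S borel (\<lambda>\<omega>. lim (\<lambda>n. backward n \<omega>))"

lemma limit_law_borel_prob: "limit_law \<in> borel_prob"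
  unfolding limit_law_def borel_prob_def
  by (simp add: prob_space.prob_space_distr[OF prob_space_stream_space])

text \<open>Prepending an independent \<xi> to a stream does not change the law of streams, and by
  continuity it turns the limit \<open>Z \<omega>\<close> into \<open>F (Z \<omega>) \<xi>\<close>.
  So \<open>Z\<close> has the law of one more step from \<open>Z\<close>.\<close>

lemma limit_law_invariant:
  assumes "(\<integral>\<^sup>+ \<xi>. ennreal (q (F 0 \<xi>)) \<partial>M) < \<infinity>"
  shows "push limit_law = limit_law"
proof -
  interpret S: prob_space S by (rule prob_space_stream_space)
  interpret P: pair_sigma_finite S M ..
  define Z where "Z \<omega> = lim (\<lambda>n. backward n \<omega>)" for \<omega>
  have [measurable]: "Z \<in> S \<rightarrow>\<^sub>M borel" unfolding Z_def by measurable
  have step: "AE \<omega> in S. Z (\<xi> ## \<omega>) = F (Z \<omega>) \<xi>" if \<xi>: "\<xi> \<in> space M" for \<xi>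
    using backward_convergent[OF assms]
  proof eventually_elim
    case (elim \<omega>)
    then have "(\<lambda>n. backward n \<omega>) \<longlonglongrightarrow> Z \<omega>" by (simp add: Z_def convergent_LIMSEQ_iff)
    then have "(\<lambda>n. F (backward n \<omega>) \<xi>) \<longlonglongrightarrow> F (Z \<omega>) \<xi>"
      by (rule isCont_tendsto_compose[OF isCont_F[OF \<xi>]])
    then have "(\<lambda>n. backward (Suc n) (\<xi> ## \<omega>)) \<longlonglongrightarrow> F (Z \<omega>) \<xi>" by simp
    then have "(\<lambda>n. backward n (\<xi> ## \<omega>)) \<longlonglongrightarrow> F (Z \<omega>) \<xi>" by (rule LIMSEQ_imp_Suc)
    then show ?case by (simp add: Z_def limI)
  qed
  have Z_law: "limit_law = distr S borel Z" by (simp only: limit_law_def Z_def[abs_def])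
  show ?thesis
  proof (rule measure_eqI)
    fix A assume "A \<in> sets (push limit_law)"
    then have [measurable]: "A \<in> sets borel" by (simp add: push_def)
    have "emeasure limit_law A = (\<integral>\<^sup>+ \<omega>. indicator A (Z \<omega>) \<partial>S)"
      unfolding Z_law by (rule emeasure_distr_nn_integral) measurable
    also have "\<dots> = (\<integral>\<^sup>+ \<xi>. (\<integral>\<^sup>+ \<omega>. indicator A (Z (\<xi> ## \<omega>)) \<partial>S) \<partial>M)"
      by (rule nn_integral_stream_space) measurable
    also have "\<dots> = (\<integral>\<^sup>+ \<xi>. (\<integral>\<^sup>+ \<omega>. indicator A (F (Z \<omega>) \<xi>) \<partial>S) \<partial>M)"
    proof (rule nn_integral_cong)
      fix \<xi> assume "\<xi> \<in> space M"
      from step[OF this] show "(\<integral>\<^sup>+ \<omega>. indicator A (Z (\<xi> ## \<omega>)) \<partial>S) = (\<integral>\<^sup>+ \<omega>. indicator A (F (Z \<omega>) \<xi>) \<partial>S)"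
        by (intro nn_integral_cong_AE) (auto elim: eventually_mono)
    qed
    also have "\<dots> = (\<integral>\<^sup>+ (\<omega>, \<xi>). indicator A (F (Z \<omega>) \<xi>) \<partial>(S \<Otimes>\<^sub>M M))"
      by (subst P.nn_integral_snd[symmetric]) (auto simp: case_prod_beta)
    also have "\<dots> = emeasure (push limit_law) A"
      unfolding Z_law push_distr[OF \<open>Z \<in> S \<rightarrow>\<^sub>M borel\<close> S.prob_space_axioms] case_prod_beta
      by (rule emeasure_distr_nn_integral[symmetric]) measurable
    finally show "emeasure (push limit_law) A = emeasure limit_law A" by simp
  qed (simp add: push_def limit_law_def)
qed

text \<open>Contraction and subadditivity bound \<open>q (F z \<xi>)\<close> by
  \<open>r * q z + q (F 0 \<xi>)\<close>. With the power split as in \<open>split\<close>, the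
  moments of the iterates obey an affine recursion with slope \<open>s powr p < 1\<close> and stay
  bounded; Fatou's lemma passes the bound to the limit.\<close>

lemma limit_law_moment:
  assumes "(\<integral>\<^sup>+ \<xi>. ennreal (q (F 0 \<xi>)) \<partial>M) < \<infinity>"
    and p: "0 < p" and moment: "(\<integral>\<^sup>+ \<xi>. ennreal (q (F 0 \<xi>) powr p) \<partial>M) < \<infinity>"
  shows "limit_law \<in> prob_moment p"
proof -
  interpret S: prob_space S by (rule prob_space_stream_space)
  obtain c where c: "(\<integral>\<^sup>+ \<xi>. ennreal (q (F 0 \<xi>) powr p) \<partial>M) = ennreal c" "0 \<le> c"
    using moment by (cases "\<integral>\<^sup>+ \<xi>. ennreal (q (F 0 \<xi>) powr p) \<partial>M") auto
  define s where "s = (1 + r) / 2"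
  define K where "K = s / (s - r)"
  have s: "0 < s" "s < 1" "r < s" using r_bounds by (auto simp: s_def)
  have K0: "0 < K" using s by (simp add: K_def)
  have sp: "s powr p < 1" using powr_less_mono2[of p s 1] s p by simp
  \<comment> \<open>A case distinction in place of Minkowski's inequality covers every
    \<open>p > 0\<close>: either \<open>y\<close> fits into the margin \<open>(s - r) * x\<close>,
    or \<open>x\<close> is below \<open>y / (s - r)\<close> and the whole sum is at most
    \<open>K * y\<close>.\<close>
  have split: "(r * x + y) powr p \<le> s powr p * x powr p + K powr p * y powr p"
    if "0 \<le> x" "0 \<le> y" for x y
  proof (cases "y \<le> (s - r) * x")
    case True
    then have "r * x + y \<le> s * x" by (simp add: algebra_simps)
    then have "(r * x + y) powr p \<le> (s * x) powr p"
      using that p r_bounds by (intro powr_mono2) auto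
    then show ?thesis using that s by (simp add: powr_mult add_increasing2)
  next
    case False
    then have "x \<le> y / (s - r)" using s by (simp add: field_simps)
    then have "r * x + y \<le> r * (y / (s - r)) + y"
      using r_bounds by (intro add_right_mono mult_left_mono) auto
    also have "\<dots> = K * y" using s by (simp add: K_def field_simps)
    finally have "(r * x + y) powr p \<le> (K * y) powr p"
      using that p r_bounds by (intro powr_mono2) auto
    then show ?thesis using that K0 by (simp add: powr_mult add_increasing)
  qed
  \<comment> \<open>The fixed point of the recursion, so the bound reproduces itself.\<close>
  define D where "D = K powr p * c / (1 - s powr p)"
  have D: "0 \<le> D" "s powr p * D + K powr p * c = D"
    using sp c by (simp_all add: D_def field_simps)
  have qp: "(\<lambda>z. ennreal (q z powr p)) \<in> borel_measurable borel" by measurable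
  have bound: "(\<integral>\<^sup>+ \<omega>. ennreal (q (backward n \<omega>) powr p) \<partial>S) \<le> ennreal D" for n
  proof (induction n)
    case (Suc n)
    have "(\<integral>\<^sup>+ \<omega>. ennreal (q (backward (Suc n) \<omega>) powr p) \<partial>S)
       = (\<integral>\<^sup>+ \<xi>. (\<integral>\<^sup>+ \<omega>. ennreal (q (F (backward n \<omega>) \<xi>) powr p) \<partial>S) \<partial>M)"
      by (subst nn_integral_stream_space[OF measurable_compose[OF backward_measurable qp]]) simp
    also have "\<dots> \<le> (\<integral>\<^sup>+ \<xi>. (\<integral>\<^sup>+ \<omega>. ennreal (s powr p) * ennreal (q (backward n \<omega>) powr p)
         + ennreal (K powr p) * ennreal (q (F 0 \<xi>) powr p) \<partial>S) \<partial>M)"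
    proof (intro nn_integral_mono)
      fix \<xi> \<omega> assume \<xi>: "\<xi> \<in> space M"
      have "q (F (backward n \<omega>) \<xi>) \<le> q (F (backward n \<omega>) \<xi> - F 0 \<xi>) + q (F 0 \<xi>)"
        using q_triangle[of "F (backward n \<omega>) \<xi> - F 0 \<xi>" "F 0 \<xi>"] by simp
      also have "\<dots> \<le> r * q (backward n \<omega>) + q (F 0 \<xi>)"
        using contraction[OF \<xi>, of "backward n \<omega>" 0] by simp
      finally have "q (F (backward n \<omega>) \<xi>) powr p \<le> (r * q (backward n \<omega>) + q (F 0 \<xi>)) powr p"
        using p q_nonneg by (intro powr_mono2) auto
      also have "\<dots> \<le> s powr p * q (backward n \<omega>) powr p + K powr p * q (F 0 \<xi>) powr p"
        by (intro split q_nonneg)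
      finally show "ennreal (q (F (backward n \<omega>) \<xi>) powr p) \<le> ennreal (s powr p) * ennreal (q (backward n \<omega>) powr p)
         + ennreal (K powr p) * ennreal (q (F 0 \<xi>) powr p)"
        by (simp flip: ennreal_mult' ennreal_plus)
    qed
    also have "\<dots> = ennreal (s powr p) * (\<integral>\<^sup>+ \<omega>. ennreal (q (backward n \<omega>) powr p) \<partial>S) + ennreal (K powr p) * ennreal c"
      by (simp add: nn_integral_add nn_integral_cmult emeasure_space_1 S.emeasure_space_1 c)
    also have "\<dots> \<le> ennreal (s powr p) * ennreal D + ennreal (K powr p) * ennreal c"
      by (intro add_mono mult_left_mono Suc.IH) auto
    also have "\<dots> = ennreal D"
      using D c by (simp flip: ennreal_mult' ennreal_plus)
    finally show ?case .
  qed (simp add: q_zero p)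
  define Z where "Z \<omega> = lim (\<lambda>n. backward n \<omega>)" for \<omega>
  have [measurable]: "Z \<in> S \<rightarrow>\<^sub>M borel" unfolding Z_def by measurable
  have "(\<integral>\<^sup>+ z. ennreal (norm z powr p) \<partial>limit_law) = (\<integral>\<^sup>+ \<omega>. ennreal (norm (Z \<omega>) powr p) \<partial>S)"
    unfolding limit_law_def Z_def[symmetric] by (simp add: nn_integral_distr)
  also have "\<dots> = (\<integral>\<^sup>+ \<omega>. liminf (\<lambda>n. ennreal (norm (backward n \<omega>) powr p)) \<partial>S)"
  proof (rule nn_integral_cong_AE)
    show "AE \<omega> in S. ennreal (norm (Z \<omega>) powr p) = liminf (\<lambda>n. ennreal (norm (backward n \<omega>) powr p))"
      using backward_convergent[OF assms(1)]
    proof eventually_elim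
      case (elim \<omega>)
      then have "(\<lambda>n. backward n \<omega>) \<longlonglongrightarrow> Z \<omega>" by (simp add: Z_def convergent_LIMSEQ_iff)
      then have "(\<lambda>n. ennreal (norm (backward n \<omega>) powr p)) \<longlonglongrightarrow> ennreal (norm (Z \<omega>) powr p)"
        using p by (intro tendsto_ennrealI tendsto_powr' tendsto_intros) auto
      then have "liminf (\<lambda>n. ennreal (norm (backward n \<omega>) powr p)) = ennreal (norm (Z \<omega>) powr p)"
        by (rule lim_imp_Liminf[OF sequentially_bot])
      then show ?case by (rule sym)
    qed
  qed
  also have "\<dots> \<le> liminf (\<lambda>n. \<integral>\<^sup>+ \<omega>. ennreal (norm (backward n \<omega>) powr p) \<partial>S)"
    by (rule nn_integral_liminf) measurable
  also have "\<dots> \<le> ennreal ((1 / a) powr p) * ennreal D"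
  proof (rule Liminf_le)
    show "\<forall>\<^sub>F n in sequentially. (\<integral>\<^sup>+ \<omega>. ennreal (norm (backward n \<omega>) powr p) \<partial>S) \<le> ennreal ((1 / a) powr p) * ennreal D"
    proof (intro always_eventually allI)
      fix n
      have "(\<integral>\<^sup>+ \<omega>. ennreal (norm (backward n \<omega>) powr p) \<partial>S)
        \<le> (\<integral>\<^sup>+ \<omega>. ennreal ((1 / a) powr p) * ennreal (q (backward n \<omega>) powr p) \<partial>S)"
      proof (rule nn_integral_mono)
        fix \<omega>
        have "norm (backward n \<omega>) powr p \<le> (1 / a * q (backward n \<omega>)) powr p"
          using norm_le_q[of "backward n \<omega>"] p by (intro powr_mono2) auto
        then show "ennreal (norm (backward n \<omega>) powr p) \<le> ennreal ((1 / a) powr p) * ennreal (q (backward n \<omega>) powr p)"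
          using a_pos q_nonneg by (simp add: powr_mult del: times_divide_eq_left flip: ennreal_mult')
      qed
      also have "\<dots> = ennreal ((1 / a) powr p) * (\<integral>\<^sup>+ \<omega>. ennreal (q (backward n \<omega>) powr p) \<partial>S)"
        by (rule nn_integral_cmult) measurable
      also have "\<dots> \<le> ennreal ((1 / a) powr p) * ennreal D" by (intro mult_left_mono bound) simp
      finally show "(\<integral>\<^sup>+ \<omega>. ennreal (norm (backward n \<omega>) powr p) \<partial>S) \<le> ennreal ((1 / a) powr p) * ennreal D" .
    qed
  qed simp
  also have "\<dots> < \<infinity>" by (simp add: ennreal_mult_less_top)
  finally show ?thesis by (simp add: prob_moment_def limit_law_borel_prob)
qed

end

section \<open>Wasserstein distances\<close>

lemma ennreal_powr_mono: "x \<le> y \<Longrightarrow> 0 \<le> s \<Longrightarrow> ennreal_powr x s \<le> ennreal_powr y s"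
  by (auto simp: ennreal_powr_def top_unique less_top intro!: ennreal_leI powr_mono2 enn2real_mono)

lemma ennreal_powr_cmult:
  assumes "0 < c" "0 < p"
  shows "ennreal_powr (ennreal (c powr p) * x) (1 / p) = ennreal c * ennreal_powr x (1 / p)"
proof (cases x)
  case (real t)
  then show ?thesis
    using assms by (simp add: ennreal_powr_def powr_mult powr_powr flip: ennreal_mult')
next
  case top
  then show ?thesis using assms by (simp add: ennreal_powr_def ennreal_mult_top)
qed

text \<open>No optimal coupling is required: every coupling of the old pair is compared with some
  coupling of the new pair, and infima are taken afterwards.\<close>

lemma wasserstein_le_cmult:
  fixes \<nu> \<mu> \<nu>' \<mu>' :: "'b::euclidean_space measure"
  assumes c: "0 < c" and p: "0 < p"
    and le: "\<And>\<rho>. \<rho> \<in> couplings \<nu> \<mu> \<Longrightarrow> \<exists>\<rho>'\<in>couplings \<nu>' \<mu>'.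
      (\<integral>\<^sup>+ (z, z'). ennreal (dist z z' powr p) \<partial>\<rho>') \<le> ennreal (c powr p) * (\<integral>\<^sup>+ (z, z'). ennreal (dist z z' powr p) \<partial>\<rho>)"
  shows "wasserstein p \<nu>' \<mu>' \<le> ennreal c * wasserstein p \<nu> \<mu>"
proof -
  define I where "I \<rho> = (\<integral>\<^sup>+ (z, z'). ennreal (dist z z' powr p) \<partial>\<rho>)" for \<rho> :: "('b \<times> 'b) measure"
  define k where "k = c powr p"
  have k: "0 < k" using c by (simp add: k_def)
  \<comment> \<open>Multiplying by \<open>1 / k\<close> and back moves the constant through the
    infimum without subtracting or dividing infinite values.\<close>
  have cancel: "ennreal k * (ennreal (1 / k) * t) = t" "ennreal (1 / k) * (ennreal k * t) = t" for t
    using k by (simp_all add: mult.assoc[symmetric] ennreal_mult'[symmetric])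
  define J where "J = (INF \<rho>\<in>couplings \<nu>' \<mu>'. I \<rho>)"
  have "ennreal (1 / k) * J \<le> I \<rho>" if \<rho>: "\<rho> \<in> couplings \<nu> \<mu>" for \<rho>
  proof -
    obtain \<rho>' where "\<rho>' \<in> couplings \<nu>' \<mu>'" "I \<rho>' \<le> ennreal k * I \<rho>"
      using le[OF \<rho>] by (auto simp: I_def k_def)
    then have "J \<le> ennreal k * I \<rho>" unfolding J_def by (auto intro: INF_lower2)
    then have "ennreal (1 / k) * J \<le> ennreal (1 / k) * (ennreal k * I \<rho>)" by (rule mult_left_mono) simp
    then show ?thesis by (simp add: cancel)
  qed
  then have "ennreal (1 / k) * J \<le> (INF \<rho>\<in>couplings \<nu> \<mu>. I \<rho>)" by (rule INF_greatest)
  then have "ennreal k * (ennreal (1 / k) * J) \<le> ennreal k * (INF \<rho>\<in>couplings \<nu> \<mu>. I \<rho>)" by (rule mult_left_mono) simp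
  then have "J \<le> ennreal (c powr p) * (INF \<rho>\<in>couplings \<nu> \<mu>. I \<rho>)"
    unfolding cancel by (simp only: k_def)
  then have "ennreal_powr J (1 / p) \<le> ennreal_powr (ennreal (c powr p) * (INF \<rho>\<in>couplings \<nu> \<mu>. I \<rho>)) (1 / p)"
    using p by (intro ennreal_powr_mono) auto
  then show ?thesis
    unfolding ennreal_powr_cmult[OF c p] wasserstein_def J_def I_def .
qed

lemma (in random_contraction) wasserstein_push_iterate:
  assumes p: "0 < p" and b: "0 < b"
  shows "wasserstein p ((push ^^ n) \<nu>) ((push ^^ n) \<mu>) \<le> ennreal (b / a * r ^ n) * wasserstein p \<nu> \<mu>"
proof (rule wasserstein_le_cmult[OF _ p])
  show "0 < b / a * r ^ n" using b a_pos r_bounds by simp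
next
  fix \<rho> assume \<rho>: "\<rho> \<in> couplings \<nu> \<mu>"
  \<comment> \<open>\<open>max 0\<close> makes \<open>g\<close> monotone on the whole line, as the
    coupling estimate demands; it changes nothing at the values of \<open>q\<close>, which are
    nonnegative.\<close>
  define g where "g t = ennreal ((max 0 t / a) powr p)" for t
  have g: "mono g" "g \<in> borel_measurable borel"
    unfolding g_def using p a_pos
    by (auto intro!: monoI ennreal_leI powr_mono2 divide_right_mono)
  have [measurable_cong]: "sets \<rho> = sets (borel \<Otimes>\<^sub>M borel)"
    by (rule sets_coupling[OF \<rho>])
  have "(\<integral>\<^sup>+ (z, z'). ennreal (dist z z' powr p) \<partial>(push2 ^^ n) \<rho>)
     \<le> (\<integral>\<^sup>+ w. g (q (fst w - snd w)) \<partial>(push2 ^^ n) \<rho>)"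
    unfolding g_def using p q_nonneg norm_le_q
    by (intro nn_integral_mono) (auto simp: dist_norm max_absorb2 intro!: ennreal_leI powr_mono2)
  also have "\<dots> \<le> (\<integral>\<^sup>+ w. g (r ^ n * q (fst w - snd w)) \<partial>\<rho>)"
    by (rule nn_integral_push2_iterate_le[OF \<rho> g])
  also have "\<dots> \<le> (\<integral>\<^sup>+ (z, z'). ennreal ((b / a * r ^ n) powr p) * ennreal (dist z z' powr p) \<partial>\<rho>)"
  proof (rule nn_integral_mono)
    fix w :: "'z \<times> 'z"
    have "max 0 (r ^ n * q (fst w - snd w)) / a \<le> b / a * r ^ n * dist (fst w) (snd w)"
    proof -
      have "r ^ n * q (fst w - snd w) \<le> r ^ n * (b * dist (fst w) (snd w))"
        using q_upper r_bounds by (intro mult_left_mono) (auto simp: dist_norm)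
      then have "r ^ n * q (fst w - snd w) / a \<le> r ^ n * (b * dist (fst w) (snd w)) / a"
        using a_pos by (intro divide_right_mono) auto
      then show ?thesis using r_bounds q_nonneg by (simp add: max_absorb2 mult_ac)
    qed
    then have "(max 0 (r ^ n * q (fst w - snd w)) / a) powr p \<le> (b / a * r ^ n * dist (fst w) (snd w)) powr p"
      using p a_pos by (intro powr_mono2) auto
    also have "\<dots> = (b / a * r ^ n) powr p * dist (fst w) (snd w) powr p"
      using b a_pos r_bounds by (subst powr_mult) auto
    finally show "g (r ^ n * q (fst w - snd w)) \<le> (case w of (z, z') \<Rightarrow> ennreal ((b / a * r ^ n) powr p) * ennreal (dist z z' powr p))"
      by (simp add: g_def case_prod_beta flip: ennreal_mult')
  qed
  also have "\<dots> = ennreal ((b / a * r ^ n) powr p) * (\<integral>\<^sup>+ (z, z'). ennreal (dist z z' powr p) \<partial>\<rho>)"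
    unfolding case_prod_beta by (rule nn_integral_cmult) measurable
  finally show "\<exists>\<rho>'\<in>couplings ((push ^^ n) \<nu>) ((push ^^ n) \<mu>).
      (\<integral>\<^sup>+ (z, z'). ennreal (dist z z' powr p) \<partial>\<rho>') \<le> ennreal ((b / a * r ^ n) powr p) * (\<integral>\<^sup>+ (z, z'). ennreal (dist z z' powr p) \<partial>\<rho>)"
    using push2_iterate_couplings[OF \<rho>] by blast
qed

subsection \<open>Gaussian noise and the twisted norm\<close>

lemma nn_integral_std_normal_density: "(\<integral>\<^sup>+ t. ennreal (std_normal_density t) \<partial>lborel) = 1"
proof -
  interpret prob_space "density lborel (\<lambda>t. ennreal (std_normal_density t))"
    by (rule prob_space_normal_density) simp
  show ?thesis using emeasure_space_1 by (simp add: emeasure_density)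
qed

lemma sets_std_gaussian [simp, measurable_cong]: "sets std_gaussian = sets borel"
  by (simp add: std_gaussian_def)

lemma space_std_gaussian [simp]: "space std_gaussian = UNIV"
  by (simp add: std_gaussian_def)

lemma prob_space_std_gaussian: "prob_space (std_gaussian :: 'a::euclidean_space measure)"
proof
  have "emeasure std_gaussian (UNIV :: 'a set) = (\<integral>\<^sup>+ x. (\<Prod>b\<in>Basis. ennreal (std_normal_density (x \<bullet> b))) \<partial>(lborel :: 'a measure))"
    by (simp add: std_gaussian_def emeasure_density prod_ennreal)
  also have "\<dots> = (\<Prod>b\<in>(Basis :: 'a set). \<integral>\<^sup>+ t. ennreal (std_normal_density t) \<partial>lborel)"
    by (rule nn_integral_lborel_prod) simp_all
  finally show "emeasure (std_gaussian :: 'a measure) (space std_gaussian) = 1"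
    by (simp add: nn_integral_std_normal_density)
qed

text \<open>Replaces the norm by a product over coordinates, so that Gaussian integrals factorise.
  Expanding the product retains 1 and the l1 norm, which dominates the Euclidean norm.\<close>

lemma one_plus_norm_le_prod: "1 + norm x \<le> (\<Prod>b\<in>Basis. 1 + \<bar>x \<bullet> b\<bar>)"
  for x :: "'a::euclidean_space"
proof -
  have "1 + (\<Sum>b\<in>A. \<bar>x \<bullet> b\<bar>) \<le> (\<Prod>b\<in>A. 1 + \<bar>x \<bullet> b\<bar>)" if "finite A" for A
    using that
  proof induction
    case (insert b A)
    have "1 \<le> (\<Prod>b\<in>A. 1 + \<bar>x \<bullet> b\<bar>)" by (intro prod_ge_1) auto
    then have "\<bar>x \<bullet> b\<bar> * 1 \<le> \<bar>x \<bullet> b\<bar> * (\<Prod>b\<in>A. 1 + \<bar>x \<bullet> b\<bar>)" by (intro mult_left_mono) auto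
    then show ?case using insert by (simp add: algebra_simps)
  qed simp
  from this[of Basis] show ?thesis using norm_le_l1[of x] by simp
qed

lemma std_gaussian_moment_finite:
  "(\<integral>\<^sup>+ x. ennreal ((1 + norm x) ^ k) \<partial>(std_gaussian :: 'a::euclidean_space measure)) < \<infinity>"
proof -
  define h where "h t = std_normal_density t * (1 + \<bar>t\<bar>) ^ k" for t :: real
  have h0: "0 \<le> h t" for t by (simp add: h_def)
  have [measurable]: "h \<in> borel_measurable borel" unfolding h_def by measurable
  \<comment> \<open>The binomial theorem reduces integrability of \<open>h\<close> to the absolute
    moments of the one-dimensional normal law.\<close>
  have "h = (\<lambda>t. \<Sum>i\<le>k. real (k choose i) * (std_normal_density t * \<bar>t\<bar> ^ i))"
  proof
    fix t show "h t = (\<Sum>i\<le>k. real (k choose i) * (std_normal_density t * \<bar>t\<bar> ^ i))"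
      using binomial_ring[of "\<bar>t\<bar>" 1 k] by (simp add: h_def sum_distrib_left mult_ac add.commute)
  qed
  moreover have "integrable lborel (\<lambda>t. \<Sum>i\<le>k. real (k choose i) * (std_normal_density t * \<bar>t\<bar> ^ i))"
    by (intro Bochner_Integration.integrable_sum integrable_mult_right integrable_std_normal_moment_abs)
  ultimately have "integrable lborel h" by simp
  then have fin: "(\<integral>\<^sup>+ t. ennreal (h t) \<partial>lborel) < \<infinity>"
    using h0 by (simp add: integrable_iff_bounded)
  have "(\<integral>\<^sup>+ x. ennreal ((1 + norm x) ^ k) \<partial>(std_gaussian :: 'a measure))
      = (\<integral>\<^sup>+ x. ennreal ((\<Prod>b\<in>Basis. std_normal_density (x \<bullet> b)) * (1 + norm x) ^ k) \<partial>(lborel :: 'a measure))"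
    unfolding std_gaussian_def by (subst nn_integral_density) (auto simp: ennreal_mult' prod_nonneg)
  also have "\<dots> \<le> (\<integral>\<^sup>+ x. (\<Prod>b\<in>Basis. ennreal (h (x \<bullet> b))) \<partial>(lborel :: 'a measure))"
  proof (rule nn_integral_mono)
    fix x :: 'a
    have "(1 + norm x) ^ k \<le> (\<Prod>b\<in>Basis. 1 + \<bar>x \<bullet> b\<bar>) ^ k"
      by (intro power_mono one_plus_norm_le_prod) simp
    then have "(\<Prod>b\<in>Basis. std_normal_density (x \<bullet> b)) * (1 + norm x) ^ k
        \<le> (\<Prod>b\<in>Basis. std_normal_density (x \<bullet> b)) * (\<Prod>b\<in>Basis. 1 + \<bar>x \<bullet> b\<bar>) ^ k"
      by (intro mult_left_mono prod_nonneg) auto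
    also have "\<dots> = (\<Prod>b\<in>Basis. h (x \<bullet> b))"
      by (simp add: h_def prod.distrib prod_power_distrib)
    finally show "ennreal ((\<Prod>b\<in>Basis. std_normal_density (x \<bullet> b)) * (1 + norm x) ^ k) \<le> (\<Prod>b\<in>Basis. ennreal (h (x \<bullet> b)))"
      by (simp add: prod_ennreal h0 ennreal_leI)
  qed
  also have "\<dots> = (\<Prod>b\<in>(Basis :: 'a set). \<integral>\<^sup>+ t. ennreal (h t) \<partial>lborel)"
    by (rule nn_integral_lborel_prod) simp_all
  also have "\<dots> < \<infinity>" using fin by (simp add: power_less_top_ennreal)
  finally show ?thesis .
qed

abbreviation gaussian_noise :: "('a::euclidean_space \<times> 'a) measure" where
  "gaussian_noise \<equiv> std_gaussian \<Otimes>\<^sub>M std_gaussian"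

lemma prob_space_gaussian_noise: "prob_space (gaussian_noise :: ('a::euclidean_space \<times> 'a) measure)"
  by (intro prob_space_pair prob_space_std_gaussian)

lemma gaussian_noise_moment_finite:
  fixes f :: "'a::euclidean_space \<times> 'a \<Rightarrow> real"
  assumes f: "\<And>\<xi>. 0 \<le> f \<xi>" "\<And>G G'. f (G, G') \<le> C * ((1 + norm G) * (1 + norm G'))" and p: "0 < p"
  shows "(\<integral>\<^sup>+ \<xi>. ennreal (f \<xi> powr p) \<partial>gaussian_noise) < \<infinity>"
proof -
  interpret G: prob_space "std_gaussian :: 'a measure" by (rule prob_space_std_gaussian)
  \<comment> \<open>The exponent may be rounded up to an integer because the base \<open>t\<close>
    below is at least 1.\<close>
  define k where "k = nat \<lceil>p\<rceil>"
  have C: "0 \<le> C" using order_trans[OF f(1) f(2)[of 0 0]] by simp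
  have "f \<xi> powr p \<le> C powr p * ((1 + norm (fst \<xi>)) ^ k * (1 + norm (snd \<xi>)) ^ k)" for \<xi>
  proof -
    define t where "t = (1 + norm (fst \<xi>)) * (1 + norm (snd \<xi>))"
    have t: "1 \<le> t" unfolding t_def using mult_mono[of 1 "1 + norm (fst \<xi>)" 1 "1 + norm (snd \<xi>)"] by simp
    have "f \<xi> powr p \<le> (C * t) powr p"
      using f(1)[of \<xi>] f(2)[of "fst \<xi>" "snd \<xi>"] p by (intro powr_mono2) (auto simp: t_def)
    also have "\<dots> = C powr p * t powr p" using C t by (simp add: powr_mult)
    also have "\<dots> \<le> C powr p * t powr real k"
      using t by (intro mult_left_mono powr_mono) (auto simp: k_def real_nat_ceiling_ge)
    also have "t powr real k = t ^ k" using t by (simp add: powr_realpow)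
    finally show ?thesis by (simp add: t_def power_mult_distrib)
  qed
  then have bound: "ennreal (f \<xi> powr p)
      \<le> ennreal (C powr p) * (ennreal ((1 + norm (fst \<xi>)) ^ k) * ennreal ((1 + norm (snd \<xi>)) ^ k))" for \<xi>
    by (simp flip: ennreal_mult')
  have "(\<integral>\<^sup>+ \<xi>. ennreal (f \<xi> powr p) \<partial>gaussian_noise)
    \<le> (\<integral>\<^sup>+ \<xi>. ennreal (C powr p) * (ennreal ((1 + norm (fst \<xi>)) ^ k) * ennreal ((1 + norm (snd \<xi>)) ^ k)) \<partial>(gaussian_noise :: ('a \<times> 'a) measure))"
    by (rule nn_integral_mono[OF bound])
  also have "\<dots> = ennreal (C powr p) * (\<integral>\<^sup>+ \<xi>. ennreal ((1 + norm (fst \<xi>)) ^ k) * ennreal ((1 + norm (snd \<xi>)) ^ k) \<partial>(gaussian_noise :: ('a \<times> 'a) measure))"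
    by (rule nn_integral_cmult) measurable
  also have "(\<integral>\<^sup>+ \<xi>. ennreal ((1 + norm (fst \<xi>)) ^ k) * ennreal ((1 + norm (snd \<xi>)) ^ k) \<partial>(gaussian_noise :: ('a \<times> 'a) measure))
     = (\<integral>\<^sup>+ G. ennreal ((1 + norm G) ^ k) \<partial>(std_gaussian :: 'a measure)) * (\<integral>\<^sup>+ G. ennreal ((1 + norm G) ^ k) \<partial>(std_gaussian :: 'a measure))"
    by (subst G.nn_integral_fst[symmetric]) (simp_all add: nn_integral_cmult nn_integral_multc)
  finally show ?thesis
    using std_gaussian_moment_finite[where 'a='a, of k]
    by (elim order_le_less_trans) (simp add: ennreal_mult_less_top)
qed

text \<open>Completing the square writes the form as the norm of a linear image, which gives the triangle inequality.\<close>

definition twisted_norm :: "real \<Rightarrow> real \<Rightarrow> 'a::euclidean_space \<times> 'a \<Rightarrow> real" where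
  "twisted_norm L \<gamma> z = norm (fst z + (1 / \<gamma>) *\<^sub>R snd z, sqrt (1 / L - 1 / \<gamma>\<^sup>2) *\<^sub>R snd z)"

lemma twisted_norm_triangle: "twisted_norm L \<gamma> (z + w) \<le> twisted_norm L \<gamma> z + twisted_norm L \<gamma> w"
proof -
  have "(fst (z + w) + (1 / \<gamma>) *\<^sub>R snd (z + w), sqrt (1 / L - 1 / \<gamma>\<^sup>2) *\<^sub>R snd (z + w))
     = (fst z + (1 / \<gamma>) *\<^sub>R snd z, sqrt (1 / L - 1 / \<gamma>\<^sup>2) *\<^sub>R snd z)
     + (fst w + (1 / \<gamma>) *\<^sub>R snd w, sqrt (1 / L - 1 / \<gamma>\<^sup>2) *\<^sub>R snd w)"
    by (simp add: scaleR_add_right)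
  then show ?thesis unfolding twisted_norm_def by (simp only: norm_triangle_ineq)
qed

section \<open>Comparison of the twisted norm with the Euclidean norm\<close>

context
  fixes L \<gamma> :: real
  assumes L: "0 < L" and \<gamma>: "2 * sqrt L \<le> \<gamma>"
begin

lemma friction_pos: "0 < \<gamma>"
  using L \<gamma> by (smt (verit) real_sqrt_gt_zero)

lemma friction_sq: "4 * L \<le> \<gamma>\<^sup>2"
proof -
  have "(2 * sqrt L)\<^sup>2 \<le> \<gamma>\<^sup>2" using L \<gamma> by (intro power_mono) auto
  then show ?thesis using L by (simp add: power_mult_distrib)
qed

lemma inverse_friction_sq: "1 / \<gamma>\<^sup>2 \<le> 1 / (4 * L)"
  using friction_sq L zero_less_power[OF friction_pos, of 2] by (intro divide_left_mono) auto

lemma twisted_norm_sq: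
  "(twisted_norm L \<gamma> z)\<^sup>2 = (norm (fst z))\<^sup>2 + 2 / \<gamma> * (fst z \<bullet> snd z) + (norm (snd z))\<^sup>2 / L"
proof -
  have "1 / (4 * L) \<le> 1 / L" using L by (simp add: field_simps)
  then have s: "0 \<le> 1 / L - 1 / \<gamma>\<^sup>2" using inverse_friction_sq by linarith
  have "(twisted_norm L \<gamma> z)\<^sup>2 = (norm (fst z + (1 / \<gamma>) *\<^sub>R snd z))\<^sup>2 + (1 / L - 1 / \<gamma>\<^sup>2) * (norm (snd z))\<^sup>2"
    using s by (simp add: twisted_norm_def norm_Pair power_mult_distrib)
  also have "(norm (fst z + (1 / \<gamma>) *\<^sub>R snd z))\<^sup>2
     = (norm (fst z))\<^sup>2 + 2 / \<gamma> * (fst z \<bullet> snd z) + 1 / \<gamma>\<^sup>2 * (norm (snd z))\<^sup>2"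
    unfolding power2_norm_eq_inner
    by (simp add: inner_simps inner_commute power2_eq_square)
  finally show ?thesis by (simp add: algebra_simps)
qed

text \<open>This is where \<gamma> being at least \<open>2 * sqrt L\<close> matters: the cross term
  takes at most half of the diagonal part, leaving the factors 1/2 and 3/2. Their ratio is the 3
  under the square root of the final constant.\<close>

lemma twisted_cross_bound:
  "\<bar>2 / \<gamma> * (x \<bullet> v)\<bar> \<le> 1 / 2 * ((norm x)\<^sup>2 + (norm v)\<^sup>2 / L)" for x v :: "'a::euclidean_space"
proof -
  have "0 \<le> (1 / 2 * norm x - 1 / \<gamma> * norm v)\<^sup>2" by simp
  then have "2 * (1 / \<gamma> * (norm x * norm v)) \<le> 2 * (1 / 4 * (norm x)\<^sup>2 + 1 / \<gamma>\<^sup>2 * (norm v)\<^sup>2)"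
    by (simp add: power2_diff power_mult_distrib power_divide mult_ac)
  moreover have "1 / \<gamma>\<^sup>2 * (norm v)\<^sup>2 \<le> 1 / (4 * L) * (norm v)\<^sup>2"
    by (intro mult_right_mono inverse_friction_sq) simp
  moreover have "1 / \<gamma> * \<bar>x \<bullet> v\<bar> \<le> 1 / \<gamma> * (norm x * norm v)"
    using friction_pos Cauchy_Schwarz_ineq2 by (intro mult_left_mono) auto
  moreover have "\<bar>2 / \<gamma> * (x \<bullet> v)\<bar> = 2 * (1 / \<gamma> * \<bar>x \<bullet> v\<bar>)"
    using friction_pos by (simp add: abs_mult)
  moreover have "1 / (4 * L) * (norm v)\<^sup>2 = 1 / 4 * ((norm v)\<^sup>2 / L)" by simp
  ultimately show ?thesis by argo
qed

lemma twisted_norm_sq_bounds: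
  shows "1 / 2 * ((norm (fst z))\<^sup>2 + (norm (snd z))\<^sup>2 / L) \<le> (twisted_norm L \<gamma> z)\<^sup>2"
    and "(twisted_norm L \<gamma> z)\<^sup>2 \<le> 3 / 2 * ((norm (fst z))\<^sup>2 + (norm (snd z))\<^sup>2 / L)"
  using twisted_cross_bound[of "fst z" "snd z"] unfolding twisted_norm_sq abs_le_iff by argo+

lemma twisted_norm_lower: "sqrt (min 1 (1 / L) / 2) * norm z \<le> twisted_norm L \<gamma> z"
proof (rule power2_le_imp_le)
  have "min 1 (1 / L) * (norm (fst z))\<^sup>2 \<le> 1 * (norm (fst z))\<^sup>2"
    "min 1 (1 / L) * (norm (snd z))\<^sup>2 \<le> 1 / L * (norm (snd z))\<^sup>2"
    by (intro mult_right_mono; simp)+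
  then have "1 / 2 * (min 1 (1 / L) * ((norm (fst z))\<^sup>2 + (norm (snd z))\<^sup>2))
      \<le> 1 / 2 * ((norm (fst z))\<^sup>2 + (norm (snd z))\<^sup>2 / L)"
    by (simp add: distrib_left)
  moreover have "(sqrt (min 1 (1 / L) / 2) * norm z)\<^sup>2
      = 1 / 2 * (min 1 (1 / L) * ((norm (fst z))\<^sup>2 + (norm (snd z))\<^sup>2))"
    using L by (simp add: power_mult_distrib norm_prod_def)
  ultimately show "(sqrt (min 1 (1 / L) / 2) * norm z)\<^sup>2 \<le> (twisted_norm L \<gamma> z)\<^sup>2"
    using twisted_norm_sq_bounds(1)[of z] by linarith
qed (simp add: twisted_norm_def)

lemma twisted_norm_upper: "twisted_norm L \<gamma> z \<le> sqrt (3 / 2 * max 1 (1 / L)) * norm z"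
proof (rule power2_le_imp_le)
  have "1 * (norm (fst z))\<^sup>2 \<le> max 1 (1 / L) * (norm (fst z))\<^sup>2"
    "1 / L * (norm (snd z))\<^sup>2 \<le> max 1 (1 / L) * (norm (snd z))\<^sup>2"
    by (intro mult_right_mono; simp)+
  then have "3 / 2 * ((norm (fst z))\<^sup>2 + (norm (snd z))\<^sup>2 / L)
      \<le> 3 / 2 * (max 1 (1 / L) * ((norm (fst z))\<^sup>2 + (norm (snd z))\<^sup>2))"
    by (simp add: distrib_left)
  moreover have "(sqrt (3 / 2 * max 1 (1 / L)) * norm z)\<^sup>2
      = 3 / 2 * (max 1 (1 / L) * ((norm (fst z))\<^sup>2 + (norm (snd z))\<^sup>2))"
    by (simp add: power_mult_distrib norm_prod_def max.coboundedI1)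
  ultimately show "(twisted_norm L \<gamma> z)\<^sup>2 \<le> (sqrt (3 / 2 * max 1 (1 / L)) * norm z)\<^sup>2"
    using twisted_norm_sq_bounds(2)[of z] by linarith
qed (simp add: max.coboundedI1)

end

text \<open>Of 1 and \<open>1 / L\<close>, whichever is larger, their quotient is
  \<open>max L (1 / L)\<close>; the square root then distributes over \<open>max\<close>.\<close>

lemma twisted_norm_ratio:
  assumes "0 < L"
  shows "sqrt (3 / 2 * max 1 (1 / L)) / sqrt (min 1 (1 / L) / 2) = sqrt 3 * max (L powr (1 / 2)) (L powr (- 1 / 2))"
proof -
  have p: "L powr (1 / 2) = sqrt L" "L powr (- 1 / 2) = sqrt (1 / L)"
    using assms powr_minus_divide[of L "1 / 2"] by (simp_all add: powr_half_sqrt real_sqrt_divide)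
  have "3 / 2 * max 1 (1 / L) / (min 1 (1 / L) / 2) = 3 * max L (1 / L)"
  proof (cases "1 \<le> L")
    case True
    then have "1 / L \<le> 1" by simp
    with True have "max 1 (1 / L) = 1" "min 1 (1 / L) = 1 / L" "max L (1 / L) = L" by linarith+
    then show ?thesis by (simp only:) simp
  next
    case False
    then have "1 \<le> 1 / L" using assms by simp
    with False have "max 1 (1 / L) = 1 / L" "min 1 (1 / L) = 1" "max L (1 / L) = 1 / L" by linarith+
    then show ?thesis by (simp only:) simp
  qed
  moreover have "sqrt (max L (1 / L)) = max (sqrt L) (sqrt (1 / L))" by (simp add: max_def)
  ultimately show ?thesis unfolding p by (simp add: real_sqrt_mult flip: real_sqrt_divide)
qed

subsection \<open>The OBABO chain\<close>

lemma obabo_step_fst: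
  "fst (obabo_step U \<gamma> \<delta> z \<xi>) = fst z + \<delta> *\<^sub>R (exp (- \<delta> * \<gamma> / 2) *\<^sub>R snd z
     + sqrt (1 - (exp (- \<delta> * \<gamma> / 2))\<^sup>2) *\<^sub>R fst \<xi>) - (\<delta>\<^sup>2 / 2) *\<^sub>R gradient U (fst z)"
  by (simp add: obabo_step_def Let_def case_prod_beta)

lemma obabo_step_snd:
  "snd (obabo_step U \<gamma> \<delta> z \<xi>) = (exp (- \<delta> * \<gamma> / 2))\<^sup>2 *\<^sub>R snd z
     - (\<delta> * exp (- \<delta> * \<gamma> / 2) / 2) *\<^sub>R (gradient U (fst z) + gradient U (fst (obabo_step U \<gamma> \<delta> z \<xi>)))
     + sqrt (1 - (exp (- \<delta> * \<gamma> / 2))\<^sup>2) *\<^sub>R (exp (- \<delta> * \<gamma> / 2) *\<^sub>R fst \<xi> + snd \<xi>)"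
  by (simp add: obabo_step_def Let_def case_prod_beta)

lemma obabo_step_measurable:
  fixes U :: "'a::euclidean_space \<Rightarrow> real"
  assumes "continuous_on UNIV (gradient U)"
  shows "(\<lambda>(z, \<xi>). obabo_step U \<gamma> \<delta> z \<xi>) \<in> borel \<Otimes>\<^sub>M gaussian_noise \<rightarrow>\<^sub>M borel"
proof -
  let ?N = "(borel \<Otimes>\<^sub>M borel) \<Otimes>\<^sub>M gaussian_noise :: (('a \<times> 'a) \<times> ('a \<times> 'a)) measure"
  have [measurable]: "gradient U \<in> borel \<rightarrow>\<^sub>M borel" by (rule borel_measurable_continuous_onI[OF assms])
  have m [measurable]: "(\<lambda>w. fst (obabo_step U \<gamma> \<delta> (fst w) (snd w))) \<in> ?N \<rightarrow>\<^sub>M borel"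
    unfolding obabo_step_fst by measurable
  have "(\<lambda>w. snd (obabo_step U \<gamma> \<delta> (fst w) (snd w))) \<in> ?N \<rightarrow>\<^sub>M borel"
    unfolding obabo_step_snd by measurable
  with m have "(\<lambda>w. (fst (obabo_step U \<gamma> \<delta> (fst w) (snd w)), snd (obabo_step U \<gamma> \<delta> (fst w) (snd w)))) \<in> ?N \<rightarrow>\<^sub>M borel \<Otimes>\<^sub>M borel"
    by (rule measurable_Pair)
  then show ?thesis by (simp only: borel_prod prod.collapse case_prod_beta')
qed

text \<open>Feeds \<open>gaussian_noise_moment_finite\<close>. A Lipschitz gradient makes the step
  from 0 grow at most linearly in the noise; the product dominates 1, \<open>norm G\<close> and
  \<open>norm G'\<close> at once and factorises under independence.\<close>

lemma obabo_step_growth: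
  fixes U :: "'a::euclidean_space \<Rightarrow> real"
  assumes L: "\<And>x y. norm (gradient U x - gradient U y) \<le> L * norm (x - y)" "0 \<le> L" and \<delta>: "0 < \<delta>"
  shows "\<exists>C. \<forall>G G'. norm (obabo_step U \<gamma> \<delta> 0 (G, G')) \<le> C * ((1 + norm G) * (1 + norm G'))"
proof -
  define \<eta> where "\<eta> = exp (- \<delta> * \<gamma> / 2)"
  define c where "c = \<bar>sqrt (1 - \<eta>\<^sup>2)\<bar>"
  define g0 where "g0 = norm (gradient U 0)"
  define A where "A = \<delta> * c + \<delta>\<^sup>2 / 2 * g0"
  define B where "B = \<delta> * \<eta> / 2 * (g0 + (g0 + L * A)) + c * (\<eta> + 1)"
  have pos: "0 \<le> \<eta>" "0 \<le> c" "0 \<le> g0" by (simp_all add: \<eta>_def c_def g0_def)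
  show ?thesis
  proof (intro exI allI)
    fix G G' :: 'a
    define t where "t = (1 + norm G) * (1 + norm G')"
    have t: "norm G \<le> t" "norm G' \<le> t" "1 \<le> t" by (simp_all add: t_def algebra_simps)
    have g0t: "g0 \<le> g0 * t" using mult_left_mono[OF t(3) pos(3)] by simp
    define x1 where "x1 = fst (obabo_step U \<gamma> \<delta> 0 (G, G'))"
    define v1 where "v1 = snd (obabo_step U \<gamma> \<delta> 0 (G, G'))"
    have "x1 = (\<delta> * sqrt (1 - \<eta>\<^sup>2)) *\<^sub>R G - (\<delta>\<^sup>2 / 2) *\<^sub>R gradient U 0"
      by (simp add: x1_def obabo_step_fst \<eta>_def)
    then have "norm x1 \<le> norm ((\<delta> * sqrt (1 - \<eta>\<^sup>2)) *\<^sub>R G) + norm ((\<delta>\<^sup>2 / 2) *\<^sub>R gradient U 0)"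
      by (simp only: norm_triangle_ineq4)
    also have "\<dots> = \<delta> * c * norm G + \<delta>\<^sup>2 / 2 * g0"
      using \<delta> by (simp add: c_def g0_def abs_mult)
    also have "\<dots> \<le> \<delta> * c * t + \<delta>\<^sup>2 / 2 * (g0 * t)"
      using t g0t \<delta> pos by (intro add_mono mult_left_mono) auto
    also have "\<dots> = A * t" by (simp add: A_def algebra_simps)
    finally have x1: "norm x1 \<le> A * t" .
    have "norm (gradient U x1) \<le> norm (gradient U x1 - gradient U 0) + norm (gradient U 0)"
      using norm_triangle_sub[of "gradient U x1" "gradient U 0"] by simp
    also have "\<dots> \<le> L * (A * t) + g0 * t"
      using L(1)[of x1 0] mult_left_mono[OF x1 L(2)] g0t by (simp add: g0_def)
    finally have gx1: "norm (gradient U x1) \<le> L * (A * t) + g0 * t" .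
    have "v1 = sqrt (1 - \<eta>\<^sup>2) *\<^sub>R (\<eta> *\<^sub>R G + G') - (\<delta> * \<eta> / 2) *\<^sub>R (gradient U 0 + gradient U x1)"
      by (simp add: v1_def x1_def obabo_step_snd[of U \<gamma> \<delta> 0 "(G, G')"] \<eta>_def)
    then have "norm v1 \<le> norm (sqrt (1 - \<eta>\<^sup>2) *\<^sub>R (\<eta> *\<^sub>R G + G')) + norm ((\<delta> * \<eta> / 2) *\<^sub>R (gradient U 0 + gradient U x1))"
      by (simp only: norm_triangle_ineq4)
    also have "\<dots> = c * norm (\<eta> *\<^sub>R G + G') + \<delta> * \<eta> / 2 * norm (gradient U 0 + gradient U x1)"
      using \<delta> pos by (simp add: c_def)
    also have "\<dots> \<le> c * (\<eta> * t + t) + \<delta> * \<eta> / 2 * (g0 * t + (L * (A * t) + g0 * t))"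
    proof (intro add_mono mult_left_mono)
      have "norm (\<eta> *\<^sub>R G + G') \<le> norm (\<eta> *\<^sub>R G) + norm G'" by (rule norm_triangle_ineq)
      then show "norm (\<eta> *\<^sub>R G + G') \<le> \<eta> * t + t"
        using t mult_left_mono[OF t(1) pos(1)] pos by simp
      show "norm (gradient U 0 + gradient U x1) \<le> g0 * t + (L * (A * t) + g0 * t)"
        using norm_triangle_ineq[of "gradient U 0" "gradient U x1", folded g0_def] gx1 g0t by linarith
    qed (use \<delta> pos in auto)
    also have "\<dots> = B * t" by (simp add: B_def algebra_simps)
    finally have v1: "norm v1 \<le> B * t" .
    have "norm (obabo_step U \<gamma> \<delta> 0 (G, G')) \<le> norm x1 + norm v1"
      using norm_Pair_le[of x1 v1] by (simp add: x1_def v1_def)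
    also have "\<dots> \<le> (A + B) * t" using x1 v1 by (simp add: algebra_simps)
    finally show "norm (obabo_step U \<gamma> \<delta> 0 (G, G')) \<le> (A + B) * ((1 + norm G) * (1 + norm G'))"
      by (simp add: t_def)
  qed
qed

text \<open>Rescaling the velocity by \<open>1 / sqrt L\<close> and time by \<open>sqrt L\<close> reduces to \<open>L = 1\<close>.\<close>

lemma obabo_step_contraction:
  fixes U :: "'a::euclidean_space \<Rightarrow> real"
  assumes D: "\<And>x. GDERIV U x :> gradient U x"
    and m: "0 < m" "m \<le> L"
    and lip: "\<And>x y. norm (gradient U x - gradient U y) \<le> L * norm (x - y)"
    and conv: "\<And>x y. m * (norm (x - y))\<^sup>2 \<le> (x - y) \<bullet> (gradient U x - gradient U y)"
    and \<gamma>: "2 * sqrt L \<le> \<gamma>" and \<delta>: "0 < \<delta>" "\<delta> \<le> m / (33 * \<gamma> ^ 3)"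
  shows "(twisted_norm L \<gamma> (obabo_step U \<gamma> \<delta> z \<xi> - obabo_step U \<gamma> \<delta> z' \<xi>))\<^sup>2
     \<le> (1 - \<delta> * (m / (3 * \<gamma>))) * (twisted_norm L \<gamma> (z - z'))\<^sup>2"
proof -
  have L: "0 < L" using m by simp
  define l where "l = sqrt L"
  have gl: "2 * l \<le> \<gamma>" using \<gamma> by (simp add: l_def)
  have l: "0 < l" "L = l\<^sup>2" using L by (simp_all add: l_def)
  have g: "0 < \<gamma>" by (rule friction_pos[OF L \<gamma>])
  have mono: "0 \<le> (x - y) \<bullet> (gradient U x - gradient U y)" for x y
    using conv[of x y] m by (smt (verit) mult_nonneg_nonneg zero_le_power2)
  have coc: "(norm (gradient U x - gradient U y))\<^sup>2 \<le> L * ((x - y) \<bullet> (gradient U x - gradient U y))" for x y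
    by (rule gradient_cocoercive[OF D L lip mono])
  define w where "w = obabo_step U \<gamma> \<delta> z \<xi>"
  define w' where "w' = obabo_step U \<gamma> \<delta> z' \<xi>"
  \<comment> \<open>Divided by \<open>L\<close>, the gradient differences are cocoercive with
    constant 1 and strongly monotone with constant \<open>m / L\<close>.\<close>
  define u0 where "u0 = (1 / L) *\<^sub>R (gradient U (fst z) - gradient U (fst z'))"
  define u1 where "u1 = (1 / L) *\<^sub>R (gradient U (fst w) - gradient U (fst w'))"
  define \<eta> where "\<eta> = exp (- \<delta> * \<gamma> / 2)"
  have scaled: "(norm ((1 / L) *\<^sub>R (gradient U x - gradient U y)))\<^sup>2 \<le> (x - y) \<bullet> ((1 / L) *\<^sub>R (gradient U x - gradient U y))"
    "m / L * (norm (x - y))\<^sup>2 \<le> (x - y) \<bullet> ((1 / L) *\<^sub>R (gradient U x - gradient U y))" for x y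
  proof -
    define e where "e = gradient U x - gradient U y"
    have e: "(norm e)\<^sup>2 \<le> L * ((x - y) \<bullet> e)" "m * (norm (x - y))\<^sup>2 \<le> (x - y) \<bullet> e"
      using coc[of x y] conv[of x y] by (simp_all only: e_def)
    have "(norm ((1 / L) *\<^sub>R e))\<^sup>2 = (norm e)\<^sup>2 / L\<^sup>2" using L by (simp add: power_divide)
    also have "\<dots> \<le> L * ((x - y) \<bullet> e) / L\<^sup>2" by (rule divide_right_mono[OF e(1)]) simp
    also have "\<dots> = (x - y) \<bullet> ((1 / L) *\<^sub>R e)" using L by (simp add: power2_eq_square)
    finally show "(norm ((1 / L) *\<^sub>R (gradient U x - gradient U y)))\<^sup>2 \<le> (x - y) \<bullet> ((1 / L) *\<^sub>R (gradient U x - gradient U y))"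
      unfolding e_def .
    have "m * (norm (x - y))\<^sup>2 / L \<le> ((x - y) \<bullet> e) / L" by (rule divide_right_mono[OF e(2)]) (use L in simp)
    then show "m / L * (norm (x - y))\<^sup>2 \<le> (x - y) \<bullet> ((1 / L) *\<^sub>R (gradient U x - gradient U y))"
      unfolding e_def[symmetric] by simp
  qed
  have grad: "gradient U (fst z) - gradient U (fst z') = L *\<^sub>R u0"
    "gradient U (fst w) - gradient U (fst w') = L *\<^sub>R u1"
    using L by (simp_all add: u0_def u1_def)
  \<comment> \<open>The scaled parameters are \<open>m / L\<close>, \<open>\<gamma> / l\<close> and
    \<open>l * \<delta>\<close>. The product of friction and time step, hence \<eta>, and the loss
    per step are unchanged, and the time-step condition scales consistently.\<close>
  have "(norm (fst w - fst w'))\<^sup>2 + 2 / (\<gamma> / l) * ((fst w - fst w') \<bullet> ((1 / l) *\<^sub>R (snd w - snd w')))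
       + (norm ((1 / l) *\<^sub>R (snd w - snd w')))\<^sup>2
    \<le> (1 - l * \<delta> * (m / L / (3 * (\<gamma> / l)))) * ((norm (fst z - fst z'))\<^sup>2
       + 2 / (\<gamma> / l) * ((fst z - fst z') \<bullet> ((1 / l) *\<^sub>R (snd z - snd z'))) + (norm ((1 / l) *\<^sub>R (snd z - snd z')))\<^sup>2)"
  proof (rule one_step_contraction)
    show "0 < m / L" "m / L \<le> 1" "0 < l * \<delta>" using m L l \<delta> by simp_all
    show "2 \<le> \<gamma> / l" using gl l(1) by (simp add: pos_le_divide_eq)
    have "l * \<delta> \<le> l * (m / (33 * \<gamma> ^ 3))" using l \<delta> by (intro mult_left_mono) auto
    also have "\<dots> = m / L / (33 * (\<gamma> / l) ^ 3)"
      using l g by (simp add: power_divide power2_eq_square power3_eq_cube)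
    finally show "l * \<delta> \<le> m / L / (33 * (\<gamma> / l) ^ 3)" .
    show "\<eta> = exp (- (l * \<delta>) * (\<gamma> / l) / 2)" using l by (simp add: \<eta>_def)
    have "fst w - fst w' = fst z - fst z' + (\<delta> * \<eta>) *\<^sub>R (snd z - snd z')
       - (\<delta>\<^sup>2 / 2) *\<^sub>R (gradient U (fst z) - gradient U (fst z'))"
      by (simp add: w_def w'_def obabo_step_fst \<eta>_def algebra_simps)
    then show "fst w - fst w' = fst z - fst z' + (l * \<delta> * \<eta>) *\<^sub>R ((1 / l) *\<^sub>R (snd z - snd z')) - ((l * \<delta>)\<^sup>2 / 2) *\<^sub>R u0"
      unfolding grad using l by (simp add: power_mult_distrib mult_ac)
    have snd_eq: "snd w - snd w' = \<eta>\<^sup>2 *\<^sub>R (snd z - snd z') - (\<delta> * \<eta> / 2) *\<^sub>R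
        ((gradient U (fst z) - gradient U (fst z')) + (gradient U (fst w) - gradient U (fst w')))"
      unfolding w_def w'_def obabo_step_snd[of U \<gamma> \<delta> z \<xi>] obabo_step_snd[of U \<gamma> \<delta> z' \<xi>] \<eta>_def[symmetric]
      by (simp add: algebra_simps)
    show "(1 / l) *\<^sub>R (snd w - snd w') = \<eta>\<^sup>2 *\<^sub>R ((1 / l) *\<^sub>R (snd z - snd z')) - (l * \<delta> * \<eta> / 2) *\<^sub>R (u0 + u1)"
      unfolding snd_eq grad using l(1)
      by (simp only: l(2) scaleR_diff_right scaleR_add_right scaleR_scaleR)
        (simp add: power2_eq_square mult_ac)
    show "(norm u0)\<^sup>2 \<le> (fst z - fst z') \<bullet> u0" "m / L * (norm (fst z - fst z'))\<^sup>2 \<le> (fst z - fst z') \<bullet> u0"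
      unfolding u0_def by (rule scaled)+
    show "(norm u1)\<^sup>2 \<le> (fst w - fst w') \<bullet> u1" "m / L * (norm (fst w - fst w'))\<^sup>2 \<le> (fst w - fst w') \<bullet> u1"
      unfolding u1_def by (rule scaled)+
  qed
  moreover have "(norm x)\<^sup>2 + 2 / (\<gamma> / l) * (x \<bullet> ((1 / l) *\<^sub>R v)) + (norm ((1 / l) *\<^sub>R v))\<^sup>2
     = (twisted_norm L \<gamma> (x, v))\<^sup>2" for x v :: 'a
    unfolding twisted_norm_sq[OF L \<gamma>] using l by (simp add: power_mult_distrib power_divide)
  moreover have "l * \<delta> * (m / L / (3 * (\<gamma> / l))) = \<delta> * (m / (3 * \<gamma>))"
    using l g by (simp add: power2_eq_square)
  ultimately show ?thesis
    by (simp add: w_def w'_def fst_diff[symmetric] snd_diff[symmetric] del: fst_diff snd_diff)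
qed

lemma obabo_rate_bounds:
  assumes m: "0 < m" "m \<le> L" and \<gamma>: "2 * sqrt L \<le> \<gamma>" and \<delta>: "0 < \<delta>" "\<delta> \<le> m / (33 * \<gamma> ^ 3)"
  shows "0 < 1 - \<delta> * (m / (3 * \<gamma>))" and "1 - \<delta> * (m / (3 * \<gamma>)) < 1"
proof -
  have L: "0 < L" using m by simp
  have g: "0 < \<gamma>" and g2: "4 * L \<le> \<gamma>\<^sup>2"
    using friction_pos[OF L \<gamma>] friction_sq[OF L \<gamma>] by simp_all
  have k: "0 < m / \<gamma>\<^sup>2" "m / \<gamma>\<^sup>2 < 1" using m g g2 by (simp_all add: field_simps)
  have "\<delta> * (m / (3 * \<gamma>)) \<le> m / (33 * \<gamma> ^ 3) * (m / (3 * \<gamma>))"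
    using \<delta> m g by (intro mult_right_mono) auto
  also have "\<dots> = (m / \<gamma>\<^sup>2)\<^sup>2 / 99"
    by (simp add: power2_eq_square power3_eq_cube)
  also have "(m / \<gamma>\<^sup>2)\<^sup>2 < 1" using k by (simp add: abs_square_less_1)
  finally show "0 < 1 - \<delta> * (m / (3 * \<gamma>))" by simp
  show "1 - \<delta> * (m / (3 * \<gamma>)) < 1" using \<delta> m g by simp
qed

text \<open>Fubini's theorem: averaging the kernel over the starting point is the same as drawing
  state and noise from the product measure.\<close>

lemma obabo_eq_distr:
  fixes U :: "'a::euclidean_space \<Rightarrow> real"
  assumes cont: "continuous_on UNIV (gradient U)" and \<nu>: "\<nu> \<in> borel_prob"
  shows "obabo U \<gamma> \<delta> \<nu> = distr (\<nu> \<Otimes>\<^sub>M gaussian_noise) borel (\<lambda>(z, \<xi>). obabo_step U \<gamma> \<delta> z \<xi>)"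
proof -
  interpret \<nu>: prob_space \<nu> using \<nu> by (simp add: borel_prob_def)
  interpret N: prob_space "gaussian_noise :: ('a \<times> 'a) measure" by (rule prob_space_gaussian_noise)
  have s: "sets \<nu> = sets borel" using \<nu> by (simp add: borel_prob_def)
  have "sets (\<nu> \<Otimes>\<^sub>M (gaussian_noise :: ('a \<times> 'a) measure)) = sets (borel \<Otimes>\<^sub>M gaussian_noise)"
    by (intro sets_pair_measure_cong s refl)
  then have m: "(\<lambda>(z, \<xi>). obabo_step U \<gamma> \<delta> z \<xi>) \<in> \<nu> \<Otimes>\<^sub>M gaussian_noise \<rightarrow>\<^sub>M borel"
    using obabo_step_measurable[OF cont] measurable_cong_sets[OF _ refl] by blast
  have "(\<lambda>_. gaussian_noise) \<in> \<nu> \<rightarrow>\<^sub>M subprob_algebra (gaussian_noise :: ('a \<times> 'a) measure)"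
    by (rule measurable_const) (simp add: space_subprob_algebra N.subprob_space_axioms)
  then have k: "obabo_kernel U \<gamma> \<delta> \<in> \<nu> \<rightarrow>\<^sub>M subprob_algebra borel"
    unfolding obabo_kernel_def[abs_def] using m by (intro measurable_distr2) auto
  show ?thesis
  proof (rule measure_eqI)
    show "sets (obabo U \<gamma> \<delta> \<nu>) = sets (distr (\<nu> \<Otimes>\<^sub>M gaussian_noise) borel (\<lambda>(z, \<xi>). obabo_step U \<gamma> \<delta> z \<xi>))"
      unfolding obabo_def by (simp add: sets_bind[OF sets_kernel[OF k] \<nu>.not_empty])
  next
    fix A assume "A \<in> sets (obabo U \<gamma> \<delta> \<nu>)"
    then have A: "A \<in> sets borel"
      unfolding obabo_def by (simp add: sets_bind[OF sets_kernel[OF k] \<nu>.not_empty])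
    have "emeasure (obabo U \<gamma> \<delta> \<nu>) A = (\<integral>\<^sup>+ z. emeasure (obabo_kernel U \<gamma> \<delta> z) A \<partial>\<nu>)"
      unfolding obabo_def by (rule emeasure_bind[OF \<nu>.not_empty k A])
    also have "\<dots> = (\<integral>\<^sup>+ z. (\<integral>\<^sup>+ \<xi>. indicator A (obabo_step U \<gamma> \<delta> z \<xi>) \<partial>gaussian_noise) \<partial>\<nu>)"
    proof (rule nn_integral_cong)
      fix z assume "z \<in> space \<nu>"
      then have "obabo_step U \<gamma> \<delta> z \<in> gaussian_noise \<rightarrow>\<^sub>M borel"
        using measurable_compose_Pair1[OF _ m] by simp
      then show "emeasure (obabo_kernel U \<gamma> \<delta> z) A = (\<integral>\<^sup>+ \<xi>. indicator A (obabo_step U \<gamma> \<delta> z \<xi>) \<partial>gaussian_noise)"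
        unfolding obabo_kernel_def using A by (rule emeasure_distr_nn_integral)
    qed
    also have "\<dots> = (\<integral>\<^sup>+ w. indicator A (case w of (z, \<xi>) \<Rightarrow> obabo_step U \<gamma> \<delta> z \<xi>) \<partial>(\<nu> \<Otimes>\<^sub>M gaussian_noise))"
      using measurable_compose[OF m borel_measurable_indicator[OF A]]
      by (subst N.nn_integral_fst[symmetric]) simp_all
    also have "\<dots> = emeasure (distr (\<nu> \<Otimes>\<^sub>M gaussian_noise) borel (\<lambda>(z, \<xi>). obabo_step U \<gamma> \<delta> z \<xi>)) A"
      by (rule emeasure_distr_nn_integral[symmetric, OF m A])
    finally show "emeasure (obabo U \<gamma> \<delta> \<nu>) A = emeasure (distr (\<nu> \<Otimes>\<^sub>M gaussian_noise) borel (\<lambda>(z, \<xi>). obabo_step U \<gamma> \<delta> z \<xi>)) A" .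
  qed
qed

theorem theorem1:
  fixes U :: "real ^ 'd \<Rightarrow> real" and m L \<gamma> \<delta> :: real
  assumes "C2 U"
    and "0 < m" and "m \<le> L"
    and "\<And>x y. norm (gradient U x - gradient U y) \<le> L * norm (x - y)"
    and "\<And>x y. (x - y) \<bullet> (gradient U x - gradient U y) \<ge> m * (norm (x - y))\<^sup>2"
    and "\<gamma> \<ge> 2 * sqrt L"
    and "0 < \<delta>" and "\<delta> \<le> m / (33 * \<gamma> ^ 3)"
  defines "P \<equiv> obabo U \<gamma> \<delta>"
    and "K1 \<equiv> sqrt 3 * max (L powr (1 / 2)) (L powr (- 1 / 2))"
    and "\<kappa> \<equiv> m / (3 * \<gamma>)"
  shows "(\<forall>p::real. p \<ge> 1 \<longrightarrow> (\<forall>(n::nat) \<nu> \<mu>. \<nu> \<in> prob_moment p \<longrightarrow> \<mu> \<in> prob_moment p \<longrightarrow>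
            wasserstein p ((P ^^ n) \<nu>) ((P ^^ n) \<mu>)
              \<le> ennreal (K1 * (1 - \<delta> * \<kappa>) powr (real n / 2)) * wasserstein p \<nu> \<mu>))
       \<and> (\<exists>!\<pi>. \<pi> \<in> borel_prob \<and> P \<pi> = \<pi>)
       \<and> (\<forall>\<pi>. \<pi> \<in> borel_prob \<and> P \<pi> = \<pi> \<longrightarrow> (\<forall>p::real. p \<ge> 1 \<longrightarrow> \<pi> \<in> prob_moment p))"
proof -
  have L: "0 < L" using assms(2,3) by simp
  have D: "GDERIV U x :> gradient U x" for x using assms(1) by (simp add: C2_def)
  have cont: "continuous_on UNIV (gradient U)"
    using assms(1) by (auto simp: C2_def continuous_on_eq_continuous_at intro: has_derivative_continuous)
  \<comment> \<open>\<open>obabo_step_contraction\<close> concerns the squared norm, so the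
    contraction factor is a square root.\<close>
  define r where "r = sqrt (1 - \<delta> * \<kappa>)"
  define a where "a = sqrt (min 1 (1 / L) / 2)"
  define b where "b = sqrt (3 / 2 * max 1 (1 / L))"
  note rate = obabo_rate_bounds[OF assms(2,3,6,7,8), folded \<kappa>_def]
  interpret random_contraction gaussian_noise "obabo_step U \<gamma> \<delta>" "twisted_norm L \<gamma>" r a b
  proof (intro random_contraction.intro random_contraction_axioms.intro)
    show "prob_space (gaussian_noise :: ((real ^ 'd) \<times> (real ^ 'd)) measure)" by (rule prob_space_gaussian_noise)
    show "(\<lambda>(z, \<xi>). obabo_step U \<gamma> \<delta> z \<xi>) \<in> borel \<Otimes>\<^sub>M gaussian_noise \<rightarrow>\<^sub>M borel"
      by (rule obabo_step_measurable[OF cont])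
    show "twisted_norm L \<gamma> \<in> borel_measurable (borel :: ((real ^ 'd) \<times> (real ^ 'd)) measure)"
      unfolding twisted_norm_def[abs_def]
      by (intro borel_measurable_continuous_onI continuous_intros)
    show "twisted_norm L \<gamma> (x + y) \<le> twisted_norm L \<gamma> x + twisted_norm L \<gamma> y" for x y :: "(real ^ 'd) \<times> (real ^ 'd)"
      by (rule twisted_norm_triangle)
    show "a * norm z \<le> twisted_norm L \<gamma> z" "twisted_norm L \<gamma> z \<le> b * norm z" for z :: "(real ^ 'd) \<times> (real ^ 'd)"
      unfolding a_def b_def using L assms(6) by (rule twisted_norm_lower twisted_norm_upper)+
    show "0 < a" using L by (simp add: a_def)
    show "0 < r" "r < 1" using rate by (simp_all add: r_def)
    show "twisted_norm L \<gamma> (obabo_step U \<gamma> \<delta> z \<xi> - obabo_step U \<gamma> \<delta> z' \<xi>) \<le> r * twisted_norm L \<gamma> (z - z')" for z z' \<xi>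
    proof (rule power2_le_imp_le)
      show "(twisted_norm L \<gamma> (obabo_step U \<gamma> \<delta> z \<xi> - obabo_step U \<gamma> \<delta> z' \<xi>))\<^sup>2 \<le> (r * twisted_norm L \<gamma> (z - z'))\<^sup>2"
        using obabo_step_contraction[OF D assms(2,3,4,5,6,7,8), of z \<xi> z'] rate
        by (simp add: r_def power_mult_distrib \<kappa>_def)
      show "0 \<le> r * twisted_norm L \<gamma> (z - z')" using rate by (simp add: r_def twisted_norm_def)
    qed
  qed
  have P: "P \<nu> = push \<nu>" if "\<nu> \<in> borel_prob" for \<nu>
    unfolding P_def push_def by (rule obabo_eq_distr[OF cont that])
  \<comment> \<open>\<open>P\<close> has been identified with \<open>push\<close> on Borel
    probability measures only, so membership is carried along in the induction.\<close>
  have Pn: "(P ^^ n) \<nu> = (push ^^ n) \<nu> \<and> (push ^^ n) \<nu> \<in> borel_prob" if "\<nu> \<in> borel_prob" for n \<nu>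
    by (induction n) (simp_all add: that P push_borel_prob)
  obtain C where C: "\<And>G G'. norm (obabo_step U \<gamma> \<delta> 0 (G, G')) \<le> C * ((1 + norm G) * (1 + norm G'))"
    using obabo_step_growth[OF assms(4) less_imp_le[OF L] assms(7)] by blast
  have b: "0 < b" by (simp add: b_def less_max_iff_disj)
  have "twisted_norm L \<gamma> (obabo_step U \<gamma> \<delta> 0 (G, G')) \<le> b * C * ((1 + norm G) * (1 + norm G'))" for G G'
    using order_trans[OF q_upper mult_left_mono[OF C less_imp_le[OF b]]] by (simp add: mult.assoc)
  then have moment: "(\<integral>\<^sup>+ \<xi>. ennreal (twisted_norm L \<gamma> (obabo_step U \<gamma> \<delta> 0 \<xi>) powr p) \<partial>gaussian_noise) < \<infinity>"
    if "0 < p" for p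
    using that by (intro gaussian_noise_moment_finite[where C="b * C"] q_nonneg)
  have moment1: "(\<integral>\<^sup>+ \<xi>. ennreal (twisted_norm L \<gamma> (obabo_step U \<gamma> \<delta> 0 \<xi>)) \<partial>gaussian_noise) < \<infinity>"
    using moment[of 1] q_nonneg by simp
  have ba: "b / a = K1" unfolding a_def b_def K1_def by (rule twisted_norm_ratio[OF L])
  have r_pow: "r ^ n = (1 - \<delta> * \<kappa>) powr (real n / 2)" for n
  proof -
    have "r = (1 - \<delta> * \<kappa>) powr (1 / 2)" using rate by (simp add: r_def powr_half_sqrt)
    then have "r powr real n = (1 - \<delta> * \<kappa>) powr (real n / 2)" by (simp only: powr_powr) simp
    moreover have "r ^ n = r powr real n" using r_bounds by (simp add: powr_realpow)
    ultimately show ?thesis by simp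
  qed
  have "wasserstein p ((P ^^ n) \<nu>) ((P ^^ n) \<mu>) \<le> ennreal (K1 * (1 - \<delta> * \<kappa>) powr (real n / 2)) * wasserstein p \<nu> \<mu>"
    if "1 \<le> p" "\<nu> \<in> prob_moment p" "\<mu> \<in> prob_moment p" for p n \<nu> \<mu>
    using wasserstein_push_iterate[of p n \<nu> \<mu>] that b Pn[of \<nu> n] Pn[of \<mu> n]
    by (simp add: ba r_pow prob_moment_def)
  moreover have inv: "limit_law \<in> borel_prob \<and> P limit_law = limit_law"
    using limit_law_borel_prob limit_law_invariant[OF moment1] P by simp
  \<comment> \<open>Every invariant law, with or without known moments, is the limit law; it
    therefore inherits all moments of the latter.\<close>
  moreover have uniq: "\<pi> = limit_law" if "\<pi> \<in> borel_prob \<and> P \<pi> = \<pi>" for \<pi>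
  proof (rule invariant_unique)
    show "push \<pi> = \<pi>" using that P[of \<pi>] by metis
  qed (use that limit_law_borel_prob limit_law_invariant[OF moment1] in blast)+
  moreover have "limit_law \<in> prob_moment p" if "1 \<le> p" for p
    using that by (intro limit_law_moment moment1 moment) auto
  ultimately show ?thesis by blast
qed

end
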